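(* For any pathograph $\mathfrak{H}$ with no rungs and urpaths $u_1,\dots,u_K$, and any finite set $\mathcal{F}$ of pathographs, there is a deterministic finite automaton $M$ over the alphabet $\Sigma_2=\{1,\dots,K\}\times 2^{V(\mathfrak{H})}$ that accepts a string $\sigma\in\Sigma_2^*$ if and only if $\sigma$ is the determination string of an $\mathcal{F}$-free realization of $\mathfrak{H}$.
   Context: All graphs are finite and simple. A pathograph is a tuple $\mathfrak{G}=(V,U,E,S,R,\pi)$ where $V$ (vertices) and $U$ (urpaths) are finite disjoint sets, $E\subseteq\binom{V}{2}$ (edges), $S\subseteq V\times U$ (spokes), $R\subseteq\binom{U}{2}$ (rungs), and $\pi:U\to\binom{V}{2}$ assigns to each urpath its two distinct endpoints, with $\pi(U)\cap E=\emptyset$. A realization of $\mathfrak{G}$ is a graph obtained as follows: start from the graph $(V,E)$; for each urpath $u$ with endpoints $a,b$ add new vertices $x_u^{(1)},\dots,x_u^{(m_u)}$ ($m_u\ge1$, the internal vertices of $u$) and the edges of the path $a x_u^{(1)}\cdots x_u^{(m_u)} b$; the only further edges added are: for each spoke $(v,u)$, a nonempty set of edges between $v$ and internal vertices of $u$; for each rung $\{u,u'\}$, a nonempty set of edges between internal vertices of $u$ and of $u'$. A graph $G$ contains a pathograph $\mathfrak{F}$ if some induced subgraph of $G$ is isomorphic to a realization of $\mathfrak{F}$; $G$ is $\mathcal{F}$-free if it contains no member of $\mathcal{F}$. Fix for each urpath $u_i$ of $\mathfrak{H}$ a left endpoint $a_i$ and right endpoint $b_i$. For a realization $G$ of $\mathfrak{H}$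 (with vertices of $\mathfrak{H}$ identified with their copies in $G$) in which $u_i$ is replaced by the path $P_i=a_i v_i^{(1)}\cdots v_i^{(k_i)} b_i$, the determination string of $G$ is the concatenation over $i=1,\dots,K$ (in order) of the strings $(i,N(v_i^{(1)})\cap V(\mathfrak{H}))(i,N(v_i^{(2)})\cap V(\mathfrak{H}))\cdots(i,N(v_i^{(k_i)})\cap V(\mathfrak{H}))$, where $N(x)$ is the neighbourhood of $x$ in $G$. *)

theory Defs
  imports Main
begin

record ('v, 'u) pathograph =
  pV :: "'v set"
  pU :: "'u set"
  pE :: "'v set set"
  pS :: "('v \<times> 'u) set"
  pR :: "'u set set"
  pEnds :: "'u \<Rightarrow> 'v set"

definition doubletons :: "'a set \<Rightarrow> 'a set set" where
  "doubletons A = {e. \<exists>a b. e = {a, b} \<and> a \<noteq> b \<and> a \<in> A \<and> b \<in> A}"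

definition wf_pathograph :: "('v, 'u) pathograph \<Rightarrow> bool" where
  "wf_pathograph P \<longleftrightarrow>
     finite (pV P) \<and> finite (pU P) \<and>
     pE P \<subseteq> doubletons (pV P) \<and>
     pS P \<subseteq> pV P \<times> pU P \<and>
     pR P \<subseteq> doubletons (pU P) \<and>
     (\<forall>u \<in> pU P. pEnds P u \<in> doubletons (pV P) \<and> pEnds P u \<notin> pE P)"

text \<open>Canonical realizations: vertex Inl v is the copy of the pathograph vertex v,
  vertex Inr (u, j) (1 \<le> j \<le> m u) is the j-th internal vertex of the urpath u,
  counted from the left endpoint lft u towards the right endpoint rgt u.\<close>

definition internal :: "('u \<Rightarrow> nat) \<Rightarrow> 'u \<Rightarrow> ('v + 'u \<times> nat) set" where
  "internal m u = {Inr (u, j) | j. 1 \<le> j \<and> j \<le> m u}"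

definition real_vertices :: "('v, 'u) pathograph \<Rightarrow> ('u \<Rightarrow> nat) \<Rightarrow> ('v + 'u \<times> nat) set" where
  "real_vertices P m = Inl ` pV P \<union> (\<Union>u \<in> pU P. internal m u)"

definition path_edges ::
  "('u \<Rightarrow> 'v) \<Rightarrow> ('u \<Rightarrow> 'v) \<Rightarrow> ('u \<Rightarrow> nat) \<Rightarrow> 'u \<Rightarrow> ('v + 'u \<times> nat) set set" where
  "path_edges lft rgt m u =
     {{Inl (lft u), Inr (u, 1)}, {Inr (u, m u), Inl (rgt u)}} \<union>
     {{Inr (u, j), Inr (u, Suc j)} | j. 1 \<le> j \<and> j < m u}"

definition spoke_edges :: "('v, 'u) pathograph \<Rightarrow> ('u \<Rightarrow> nat) \<Rightarrow> ('v + 'u \<times> nat) set set" where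
  "spoke_edges P m = {{Inl v, x} | v u x. (v, u) \<in> pS P \<and> x \<in> internal m u}"

definition rung_edges :: "('v, 'u) pathograph \<Rightarrow> ('u \<Rightarrow> nat) \<Rightarrow> ('v + 'u \<times> nat) set set" where
  "rung_edges P m = {{x, y} | u u' x y. {u, u'} \<in> pR P \<and> u \<noteq> u' \<and> x \<in> internal m u \<and> y \<in> internal m u'}"

definition is_realization ::
  "('v, 'u) pathograph \<Rightarrow> ('u \<Rightarrow> 'v) \<Rightarrow> ('u \<Rightarrow> 'v) \<Rightarrow> ('u \<Rightarrow> nat)
     \<Rightarrow> ('v + 'u \<times> nat) set set \<Rightarrow> bool" where
  "is_realization P lft rgt m EG \<longleftrightarrow>
     (\<forall>u \<in> pU P. pEnds P u = {lft u, rgt u} \<and> 1 \<le> m u) \<and>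
     (image Inl) ` pE P \<subseteq> EG \<and>
     (\<forall>u \<in> pU P. path_edges lft rgt m u \<subseteq> EG) \<and>
     EG \<subseteq> (image Inl) ` pE P \<union> (\<Union>u \<in> pU P. path_edges lft rgt m u)
            \<union> spoke_edges P m \<union> rung_edges P m \<and>
     (\<forall>(v, u) \<in> pS P. \<exists>x \<in> internal m u. {Inl v, x} \<in> EG) \<and>
     (\<forall>u u'. {u, u'} \<in> pR P \<and> u \<noteq> u' \<longrightarrow>
        (\<exists>x \<in> internal m u. \<exists>y \<in> internal m u'. {x, y} \<in> EG))"

definition contains_pathograph ::
  "'w set \<Rightarrow> 'w set set \<Rightarrow> ('a, 'b) pathograph \<Rightarrow> bool" where
  "contains_pathograph VG EG F \<longleftrightarrow>
     (\<exists>lft rgt m ER f. is_realization F lft rgt m ER \<and>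
        inj_on f (real_vertices F m) \<and> f ` real_vertices F m \<subseteq> VG \<and>
        (\<forall>x \<in> real_vertices F m. \<forall>y \<in> real_vertices F m. x \<noteq> y \<longrightarrow>
            ({x, y} \<in> ER \<longleftrightarrow> {f x, f y} \<in> EG)))"

definition pathograph_free ::
  "'w set \<Rightarrow> 'w set set \<Rightarrow> ('a, 'b) pathograph set \<Rightarrow> bool" where
  "pathograph_free VG EG \<F> \<longleftrightarrow> (\<forall>F \<in> \<F>. \<not> contains_pathograph VG EG F)"

text \<open>Determination string w.r.t. the urpath enumeration us = [u_1, ..., u_K]
  (letter (i, N(v_i^(j)) \<inter> V(H)), indices i counted from 1).\<close>

definition determination_string ::
  "('v, 'u) pathograph \<Rightarrow> 'u list \<Rightarrow> ('u \<Rightarrow> nat) \<Rightarrow> ('v + 'u \<times> nat) set set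
     \<Rightarrow> (nat \<times> 'v set) list" where
  "determination_string H us m EG =
     concat (map (\<lambda>i. map (\<lambda>j. (Suc i, {v \<in> pV H. {Inl v, Inr (us ! i, j)} \<in> EG}))
                          [1..<Suc (m (us ! i))])
                 [0..<length us])"

definition dfa_run :: "('q \<Rightarrow> 'c \<Rightarrow> 'q) \<Rightarrow> 'q \<Rightarrow> 'c list \<Rightarrow> 'q" where
  "dfa_run \<delta> q w = fold (\<lambda>c p. \<delta> p c) w q"

definition is_dfa :: "'q set \<Rightarrow> 'c set \<Rightarrow> ('q \<Rightarrow> 'c \<Rightarrow> 'q) \<Rightarrow> 'q \<Rightarrow> 'q set \<Rightarrow> bool" where
  "is_dfa Q \<Sigma> \<delta> q0 Acc \<longleftrightarrow> finite Q \<and> q0 \<in> Q \<and> Acc \<subseteq> Q \<and> (\<forall>q \<in> Q. \<forall>c \<in> \<Sigma>. \<delta> q c \<in> Q)"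

definition dfa_accepts :: "('q \<Rightarrow> 'c \<Rightarrow> 'q) \<Rightarrow> 'q \<Rightarrow> 'q set \<Rightarrow> 'c list \<Rightarrow> bool" where
  "dfa_accepts \<delta> q0 Acc w \<longleftrightarrow> dfa_run \<delta> q0 w \<in> Acc"

end

theory Submission
  imports Defs
begin

text \<open>A string over the alphabet of the theorem, preceded by one letter for each vertex of H,
  carries a graph on its positions: whether two positions are adjacent depends only on their letters
  and on whether they are consecutive. For the determination string of a realization this graph is
  isomorphic to the realization. Containing a pathograph F is a monadic second-order property of the
  graph: one guesses the sets of vertices playing the role of each vertex and each urpath of F, and
  the interior of an urpath is characterised as a minimal set connecting its two ends. Hence
  it is a regular property of the string; so is being a determination string at all, and the
  automaton is obtained from the finitely many residuals.\<close>

section \<open>Regular languages as languages with finitely many residuals\<close>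

text \<open>Realizations of a member of \<F> may be arbitrarily large, so no finite list of
  forbidden induced subgraphs is at hand; this is what calls for quantification over sets. Rungs of
  H would join interior vertices at arbitrary distance in patterns that the determination string
  does not record. Without them, two interior vertices are adjacent exactly when they are
  consecutive on one urpath, and all other adjacencies can be read off the two letters. Rungs in a
  member of \<F> do no harm, since it is only tested whether two guessed sets are joined by an edge.
  The vertices of H form a fixed prefix so that they are positions too; a left quotient removes this
  prefix in the end. Regularity is taken in the Myhill-Nerode form because every closure property
  then only asks for an invariant of the words read so far that has finitely many values.\<close>

definition residual :: "'c set \<Rightarrow> ('c list \<Rightarrow> bool) \<Rightarrow> 'c list \<Rightarrow> 'c list set" where
  "residual \<Sigma> P u = {v \<in> lists \<Sigma>. P (u @ v)}"

text \<open>By Myhill-Nerode these are the regular languages when the alphabet is finite. The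
  predicate is defined on all lists, but only its values on \<open>lists \<Sigma>\<close>
  matter.\<close>

definition regular :: "'c set \<Rightarrow> ('c list \<Rightarrow> bool) \<Rightarrow> bool" where
  "regular \<Sigma> P \<longleftrightarrow> finite (residual \<Sigma> P ` lists \<Sigma>)"

lemma residual_eqD:
  "residual \<Sigma> P u = residual \<Sigma> P u' \<Longrightarrow> v \<in> lists \<Sigma> \<Longrightarrow> P (u @ v) = P (u' @ v)"
  unfolding residual_def by blast

text \<open>Equality of \<open>f\<close> refines the Myhill-Nerode congruence, so taking residuals
  factors through a finite set. One implication suffices because \<open>u\<close> and
  \<open>u'\<close> can be exchanged.\<close>

lemma regularI:
  assumes fin: "finite (f ` lists \<Sigma>)"
    and imp: "\<And>u u' v. \<lbrakk>u \<in> lists \<Sigma>; u' \<in> lists \<Sigma>; v \<in> lists \<Sigma>; f u = f u'; P (u @ v)\<rbrakk> \<Longrightarrow> P (u' @ v)"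
  shows "regular \<Sigma> P"
proof -
  define g where "g s = residual \<Sigma> P (SOME u. u \<in> lists \<Sigma> \<and> f u = s)" for s
  have "residual \<Sigma> P u = g (f u)" if "u \<in> lists \<Sigma>" for u
  proof -
    define u' where "u' = (SOME u'. u' \<in> lists \<Sigma> \<and> f u' = f u)"
    have "u' \<in> lists \<Sigma> \<and> f u' = f u"
      unfolding u'_def by (rule someI[of _ u]) (use that in simp)
    then have "residual \<Sigma> P u = residual \<Sigma> P u'"
      unfolding residual_def using imp[of u u'] imp[of u' u] that by (intro Collect_cong) metis
    then show ?thesis
      unfolding g_def u'_def .
  qed
  then have "residual \<Sigma> P ` lists \<Sigma> \<subseteq> g ` f ` lists \<Sigma>"
    by blast
  then show ?thesis
    unfolding regular_def by (rule finite_subset) (use fin in simp)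
qed

lemma regular_cong:
  assumes "\<And>w. w \<in> lists \<Sigma> \<Longrightarrow> P w = Q w"
  shows "regular \<Sigma> P = regular \<Sigma> Q"
proof -
  have "residual \<Sigma> P u = residual \<Sigma> Q u" if "u \<in> lists \<Sigma>" for u
    unfolding residual_def using assms[of "u @ _"] that by (auto simp del: in_lists_conv_set)
  then show ?thesis
    unfolding regular_def by simp
qed

lemma finite_image_Pair:
  assumes "finite (f ` A)" "finite (g ` A)"
  shows "finite ((\<lambda>u. (f u, g u)) ` A)"
  by (rule finite_subset[of _ "f ` A \<times> g ` A"]) (use assms in auto)

section \<open>Closure properties of regular languages\<close>

lemma regular_not: "regular \<Sigma> P \<Longrightarrow> regular \<Sigma> (\<lambda>w. \<not> P w)"
  unfolding regular_def[of _ P]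
  by (rule regularI[where f = "residual \<Sigma> P"]) (auto dest: residual_eqD)

lemma regular_conj:
  assumes "regular \<Sigma> P" "regular \<Sigma> Q"
  shows "regular \<Sigma> (\<lambda>w. P w \<and> Q w)"
  by (rule regularI[where f = "\<lambda>u. (residual \<Sigma> P u, residual \<Sigma> Q u)"])
    (use assms in \<open>auto simp: regular_def finite_image_Pair dest: residual_eqD\<close>)

lemma regular_const: "regular \<Sigma> (\<lambda>_. b)"
  by (rule regularI[where f = "\<lambda>_. ()"]) auto

lemma regular_disj:
  assumes "regular \<Sigma> P" "regular \<Sigma> Q"
  shows "regular \<Sigma> (\<lambda>w. P w \<or> Q w)"
  using regular_not[OF regular_conj[OF regular_not[OF assms(1)] regular_not[OF assms(2)]]] by simp

lemma regular_ball:
  assumes "finite I" "\<And>i. i \<in> I \<Longrightarrow> regular \<Sigma> (P i)"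
  shows "regular \<Sigma> (\<lambda>w. \<forall>i\<in>I. P i w)"
  using assms by (induction I rule: finite_induct) (auto intro: regular_const regular_conj)

lemma regular_map:
  assumes "regular \<Sigma>' P" "\<And>c. c \<in> \<Sigma> \<Longrightarrow> h c \<in> \<Sigma>'"
  shows "regular \<Sigma> (\<lambda>w. P (map h w))"
proof (rule regularI[where f = "\<lambda>u. residual \<Sigma>' P (map h u)"])
  have "(\<lambda>u. residual \<Sigma>' P (map h u)) ` lists \<Sigma> \<subseteq> residual \<Sigma>' P ` lists \<Sigma>'"
    using assms(2) by (auto intro!: imageI)
  then show "finite ((\<lambda>u. residual \<Sigma>' P (map h u)) ` lists \<Sigma>)"
    using assms(1) finite_subset unfolding regular_def by blast
next
  fix u u' v
  assume "v \<in> lists \<Sigma>" "residual \<Sigma>' P (map h u) = residual \<Sigma>' P (map h u')" "P (map h (u @ v))"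
  moreover from this have "map h v \<in> lists \<Sigma>'"
    using assms(2) by auto
  ultimately show "P (map h (u' @ v))"
    by (auto dest: residual_eqD)
qed

text \<open>This is the subset construction, and the source of existential set quantification. A
  prefix \<open>u\<close> is remembered by the residuals of all its lifts \<open>y\<close>, which
  form a subset of a finite set. Two maps occur because words over two alphabets are compared after
  erasure.\<close>

lemma regular_projection:
  assumes "regular \<Sigma> P"
  shows "regular \<Sigma>' (\<lambda>w. \<exists>y\<in>lists \<Sigma>. map h y = map g w \<and> P y)"
proof (rule regularI[where f = "\<lambda>u. residual \<Sigma> P ` {y \<in> lists \<Sigma>. map h y = map g u}"])
  show "finite ((\<lambda>u. residual \<Sigma> P ` {y \<in> lists \<Sigma>. map h y = map g u}) ` lists \<Sigma>')"
    by (rule finite_subset[of _ "Pow (residual \<Sigma> P ` lists \<Sigma>)"])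
      (use assms in \<open>auto simp: regular_def\<close>)
next
  fix u u' v
  assume eq: "residual \<Sigma> P ` {y \<in> lists \<Sigma>. map h y = map g u} =
      residual \<Sigma> P ` {y \<in> lists \<Sigma>. map h y = map g u'}"
    and "\<exists>y\<in>lists \<Sigma>. map h y = map g (u @ v) \<and> P y"
  then obtain y where "y \<in> lists \<Sigma>" "map h y = map g u @ map g v" "P y"
    by auto
  then obtain y1 y2 where y: "y1 @ y2 \<in> lists \<Sigma>" "map h y1 = map g u" "map h y2 = map g v" "P (y1 @ y2)"
    unfolding map_eq_append_conv by metis
  then have "residual \<Sigma> P y1 \<in> residual \<Sigma> P ` {y \<in> lists \<Sigma>. map h y = map g u'}"
    unfolding eq[symmetric] by auto
  then obtain y1' where "y1' \<in> lists \<Sigma>" "map h y1' = map g u'" "residual \<Sigma> P y1 = residual \<Sigma> P y1'"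
    by auto
  with y show "\<exists>y\<in>lists \<Sigma>. map h y = map g (u' @ v) \<and> P y"
    by (intro bexI[of _ "y1' @ y2"]) (auto dest: residual_eqD)
qed

text \<open>Serves to strip the fixed word of vertex letters in front of a determination
  string.\<close>

lemma regular_left_quotient:
  assumes "regular \<Sigma> P" "p \<in> lists \<Sigma>"
  shows "regular \<Sigma> (\<lambda>w. P (p @ w))"
proof (rule regularI[where f = "\<lambda>u. residual \<Sigma> P (p @ u)"])
  have "(\<lambda>u. residual \<Sigma> P (p @ u)) ` lists \<Sigma> \<subseteq> residual \<Sigma> P ` lists \<Sigma>"
    using assms(2) by (auto intro!: imageI)
  then show "finite ((\<lambda>u. residual \<Sigma> P (p @ u)) ` lists \<Sigma>)"
    using assms(1) finite_subset unfolding regular_def by blast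
next
  fix u u' v
  assume "v \<in> lists \<Sigma>" "residual \<Sigma> P (p @ u) = residual \<Sigma> P (p @ u')" "P (p @ u @ v)"
  then show "P (p @ u' @ v)"
    by (auto dest: residual_eqD)
qed

text \<open>The cut between the factors falls either in \<open>v\<close>, where the residual of
  \<open>P\<close> decides, or inside \<open>u\<close>. In the second case it matters which
  residuals of \<open>Q\<close> belong to the remainders of \<open>u\<close> behind a prefix
  satisfying \<open>P\<close>.\<close>

lemma regular_append:
  assumes "regular \<Sigma> P" "regular \<Sigma> Q"
  shows "regular \<Sigma> (\<lambda>w. \<exists>x y. w = x @ y \<and> P x \<and> Q y)"
proof (rule regularI[where f = "\<lambda>u. (residual \<Sigma> P u, residual \<Sigma> Q ` {y. \<exists>x. u = x @ y \<and> P x})"])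
  have "finite ((\<lambda>u. residual \<Sigma> Q ` {y. \<exists>x. u = x @ y \<and> P x}) ` lists \<Sigma>)"
    by (rule finite_subset[of _ "Pow (residual \<Sigma> Q ` lists \<Sigma>)"])
      (use assms in \<open>auto simp: regular_def\<close>)
  then show "finite ((\<lambda>u. (residual \<Sigma> P u, residual \<Sigma> Q ` {y. \<exists>x. u = x @ y \<and> P x})) ` lists \<Sigma>)"
    using assms(1) by (intro finite_image_Pair) (auto simp: regular_def)
next
  fix u u' v
  assume v: "v \<in> lists \<Sigma>" and eq: "(residual \<Sigma> P u, residual \<Sigma> Q ` {y. \<exists>x. u = x @ y \<and> P x}) =
      (residual \<Sigma> P u', residual \<Sigma> Q ` {y. \<exists>x. u' = x @ y \<and> P x})"
    and "\<exists>x y. u @ v = x @ y \<and> P x \<and> Q y"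
  then obtain x y where xy: "u @ v = x @ y" "P x" "Q y"
    by auto
  then consider z where "u @ z = x" "v = z @ y" | z where "u = x @ z" "z @ v = y"
    by (auto simp: append_eq_append_conv2)
  then show "\<exists>x y. u' @ v = x @ y \<and> P x \<and> Q y"
  proof cases
    case 1
    then have "P (u' @ z)"
      using eq v xy residual_eqD[of \<Sigma> P u u' z] by auto
    then show ?thesis
      using 1 xy by (intro exI[of _ "u' @ z"] exI[of _ y]) auto
  next
    case 2
    then have "residual \<Sigma> Q z \<in> residual \<Sigma> Q ` {y. \<exists>x. u' = x @ y \<and> P x}"
      using xy eq by blast
    then obtain x' z' where *: "residual \<Sigma> Q z = residual \<Sigma> Q z'" "u' = x' @ z'" "P x'"
      by auto
    then have "Q (z' @ v)"
      using 2 xy v by (auto dest: residual_eqD)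
    then show ?thesis
      using * by (intro exI[of _ x'] exI[of _ "z' @ v"]) auto
  qed
qed

section \<open>Basic regular languages\<close>

lemma finite_image_bool: "finite ((f :: 'a \<Rightarrow> bool) ` A)"
  by (rule finite_subset[of _ UNIV]) auto

lemma regular_Nil: "regular \<Sigma> (\<lambda>w. w = [])"
  by (rule regularI[where f = "\<lambda>u. u = []"]) (auto intro: finite_image_bool)

lemma regular_lists: "regular \<Sigma> (\<lambda>w. w \<in> lists M)"
  by (rule regularI[where f = "\<lambda>u. u \<in> lists M"]) (auto intro: finite_image_bool simp del: in_lists_conv_set)

lemma regular_letter: "regular \<Sigma> (\<lambda>w. \<exists>c\<in>M. w = [c])"
  by (rule regularI[where f = "\<lambda>u. (u = [], \<exists>c\<in>M. u = [c])"])
    (auto intro!: finite_image_Pair finite_image_bool simp: append_eq_Cons_conv)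

lemma regular_ex_letter: "regular \<Sigma> (\<lambda>w. \<exists>c\<in>set w. \<phi> c)"
  by (rule regularI[where f = "\<lambda>u. \<exists>c\<in>set u. \<phi> c"]) (auto intro: finite_image_bool)

text \<open>A later letter can only conflict with letters that have already occurred, so the set of
  letters of the prefix is enough memory.\<close>

lemma regular_sorted_wrt:
  assumes "finite \<Sigma>"
  shows "regular \<Sigma> (sorted_wrt R)"
proof (rule regularI[where f = "\<lambda>u. (sorted_wrt R u, set u)"])
  have "set ` lists \<Sigma> \<subseteq> Pow \<Sigma>"
    by auto
  then have "finite (set ` lists \<Sigma>)"
    using assms finite_subset by blast
  then show "finite ((\<lambda>u. (sorted_wrt R u, set u)) ` lists \<Sigma>)"
    by (intro finite_image_Pair finite_image_bool)
qed (auto simp: sorted_wrt_append)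

text \<open>The only new pair across the cut involves the last letter of the prefix.\<close>

lemma regular_successively:
  assumes "finite \<Sigma>"
  shows "regular \<Sigma> (successively R)"
proof (rule regularI[where f = "\<lambda>u. (successively R u, u = [], last u)"])
  have "last ` lists \<Sigma> \<subseteq> insert (last []) \<Sigma>"
    by auto (metis in_listsD last_in_set lists.Nil)
  then have "finite (last ` lists \<Sigma>)"
    using assms finite_subset by blast
  then show "finite ((\<lambda>u. (successively R u, u = [], last u)) ` lists \<Sigma>)"
    by (intro finite_image_Pair finite_image_bool)
qed (auto simp: successively_append_iff)

text \<open>This is the Myhill-Nerode automaton. Its states are the residuals, coded as natural
  numbers; reading \<open>c\<close> passes to the derivative by \<open>c\<close>, and a residual
  accepts when it contains the empty word.\<close>

lemma regular_imp_dfa: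
  assumes "regular \<Sigma> P"
  shows "\<exists>(Q :: nat set) \<delta> q0 Acc. is_dfa Q \<Sigma> \<delta> q0 Acc \<and>
    (\<forall>w\<in>lists \<Sigma>. dfa_accepts \<delta> q0 Acc w \<longleftrightarrow> P w)"
proof -
  let ?S = "residual \<Sigma> P ` lists \<Sigma>"
  obtain e :: "'a list set \<Rightarrow> nat" where inj: "inj_on e ?S"
    using assms finite_imp_inj_to_nat_seg unfolding regular_def by metis
  define d where "d = inv_into ?S e"
  have d: "d (e (residual \<Sigma> P u)) = residual \<Sigma> P u" if "u \<in> lists \<Sigma>" for u
    unfolding d_def using inj that by (intro inv_into_f_f) auto
  define \<delta> where "\<delta> q c = e {v. c # v \<in> d q}" for q c
  have \<delta>: "\<delta> (e (residual \<Sigma> P u)) c = e (residual \<Sigma> P (u @ [c]))" if "u \<in> lists \<Sigma>" "c \<in> \<Sigma>" for u c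
    unfolding \<delta>_def d[OF that(1)] by (rule arg_cong[of _ _ e]) (use that in \<open>auto simp: residual_def\<close>)
  define Acc where "Acc = e ` {q \<in> ?S. [] \<in> q}"
  have run: "dfa_run \<delta> (e (residual \<Sigma> P [])) w = e (residual \<Sigma> P w)" if "w \<in> lists \<Sigma>" for w
    using that by (induction w rule: rev_induct) (auto simp: dfa_run_def \<delta>)
  show ?thesis
  proof (intro exI conjI ballI)
    show "is_dfa (e ` ?S) \<Sigma> \<delta> (e (residual \<Sigma> P [])) Acc"
      using assms by (auto simp: is_dfa_def regular_def Acc_def \<delta> intro!: imageI)
  next
    fix w assume w: "w \<in> lists \<Sigma>"
    then have "residual \<Sigma> P w \<in> ?S"
      by (rule imageI)
    then have "e (residual \<Sigma> P w) \<in> Acc \<longleftrightarrow> residual \<Sigma> P w \<in> {q \<in> ?S. [] \<in> q}"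
      unfolding Acc_def by (intro inj_on_image_mem_iff[OF inj]) auto
    also have "\<dots> \<longleftrightarrow> [] \<in> residual \<Sigma> P w"
      using \<open>residual \<Sigma> P w \<in> ?S\<close> by (simp only: mem_Collect_eq) blast
    finally have "dfa_accepts \<delta> (e (residual \<Sigma> P [])) Acc w \<longleftrightarrow> [] \<in> residual \<Sigma> P w"
      unfolding dfa_accepts_def run[OF w] .
    then show "dfa_accepts \<delta> (e (residual \<Sigma> P [])) Acc w \<longleftrightarrow> P w"
      by (simp add: residual_def)
  qed
qed

section \<open>Monadic second-order properties of words\<close>

text \<open>A valuation of the set variables in K is written into the word: the letter at position p
  carries the set of those variables whose value contains p.\<close>

definition track :: "('c \<times> 'n set) list \<Rightarrow> 'n \<Rightarrow> nat set" where
  "track x k = {p. p < length x \<and> k \<in> snd (x ! p)}"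

text \<open>A semantic notion of definability: there is no datatype of formulas, and the closure
  lemmas below act as the formation rules. Variables outside \<open>K\<close> carry the empty set,
  because letters only list members of \<open>K\<close>.\<close>

definition mso :: "'c set \<Rightarrow> 'n set \<Rightarrow> ('c list \<Rightarrow> ('n \<Rightarrow> nat set) \<Rightarrow> bool) \<Rightarrow> bool" where
  "mso \<Gamma> K Q \<longleftrightarrow> regular (\<Gamma> \<times> Pow K) (\<lambda>x. Q (map fst x) (track x))"

lemma map_fst_in_lists: "x \<in> lists (\<Gamma> \<times> A) \<Longrightarrow> map fst x \<in> lists \<Gamma>"
  by fastforce

lemma mso_cong:
  assumes "\<And>w I. w \<in> lists \<Gamma> \<Longrightarrow> (\<And>k. I k \<subseteq> {..<length w}) \<Longrightarrow> Q w I = Q' w I"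
  shows "mso \<Gamma> K Q = mso \<Gamma> K Q'"
  unfolding mso_def by (intro regular_cong assms map_fst_in_lists) (auto simp: track_def)

lemma mso_not: "mso \<Gamma> K Q \<Longrightarrow> mso \<Gamma> K (\<lambda>w I. \<not> Q w I)"
  unfolding mso_def by (rule regular_not)

lemma mso_conj: "mso \<Gamma> K Q \<Longrightarrow> mso \<Gamma> K Q' \<Longrightarrow> mso \<Gamma> K (\<lambda>w I. Q w I \<and> Q' w I)"
  unfolding mso_def by (rule regular_conj)

lemma mso_disj: "mso \<Gamma> K Q \<Longrightarrow> mso \<Gamma> K Q' \<Longrightarrow> mso \<Gamma> K (\<lambda>w I. Q w I \<or> Q' w I)"
  unfolding mso_def by (rule regular_disj)

lemma mso_const: "mso \<Gamma> K (\<lambda>w I. b)"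
  unfolding mso_def by (rule regular_const)

lemma mso_imp: "mso \<Gamma> K Q \<Longrightarrow> mso \<Gamma> K Q' \<Longrightarrow> mso \<Gamma> K (\<lambda>w I. Q w I \<longrightarrow> Q' w I)"
  unfolding imp_conv_disj by (intro mso_disj mso_not)

lemma mso_iff: "mso \<Gamma> K Q \<Longrightarrow> mso \<Gamma> K Q' \<Longrightarrow> mso \<Gamma> K (\<lambda>w I. Q w I \<longleftrightarrow> Q' w I)"
  unfolding iff_conv_conj_imp by (intro mso_conj mso_imp)

lemma mso_ball: "finite A \<Longrightarrow> (\<And>i. i \<in> A \<Longrightarrow> mso \<Gamma> K (Q i)) \<Longrightarrow> mso \<Gamma> K (\<lambda>w I. \<forall>i\<in>A. Q i w I)"
  unfolding mso_def by (rule regular_ball)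

lemma mso_bex:
  assumes "finite A" "\<And>i. i \<in> A \<Longrightarrow> mso \<Gamma> K (Q i)"
  shows "mso \<Gamma> K (\<lambda>w I. \<exists>i\<in>A. Q i w I)"
  using mso_not[OF mso_ball[OF assms(1) mso_not[OF assms(2)]]] by simp

text \<open>A choice of values for the variables in \<open>K0\<close> amounts to a word that agrees
  with the given one once the \<open>K0\<close> part of every letter is erased. Hence quantification
  over a whole family is a single projection, with the erasing map on both sides.\<close>

lemma mso_ex_family:
  assumes "mso \<Gamma> K Q" "K0 \<subseteq> K"
  shows "mso \<Gamma> K (\<lambda>w I. \<exists>J. (\<forall>k. J k \<subseteq> {..<length w}) \<and> Q w (\<lambda>k. if k \<in> K0 then J k else I k))"
proof -
  define h :: "'a \<times> 'b set \<Rightarrow> 'a \<times> 'b set" where "h = (\<lambda>(c, N). (c, N - K0))"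
  let ?\<Delta> = "\<Gamma> \<times> Pow K"
  have eq: "(\<exists>y\<in>lists ?\<Delta>. map h y = map h x \<and> Q (map fst y) (track y)) \<longleftrightarrow>
      (\<exists>J. (\<forall>k. J k \<subseteq> {..<length (map fst x)}) \<and> Q (map fst x) (\<lambda>k. if k \<in> K0 then J k else track x k))"
    (is "?L \<longleftrightarrow> ?R") if x: "x \<in> lists ?\<Delta>" for x
  proof
    assume ?L
    then obtain y where y: "y \<in> lists ?\<Delta>" "map h y = map h x" "Q (map fst y) (track y)"
      by blast
    have len: "length y = length x"
      using y(2) map_eq_imp_length_eq by blast
    have nth: "fst (y ! p) = fst (x ! p)" "snd (y ! p) - K0 = snd (x ! p) - K0" if "p < length x" for p
    proof -
      have "h (y ! p) = h (x ! p)"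
        using that y(2) len by (metis nth_map)
      then show "fst (y ! p) = fst (x ! p)" "snd (y ! p) - K0 = snd (x ! p) - K0"
        by (auto simp: h_def split: prod.splits)
    qed
    have "map fst y = map fst x"
      by (rule nth_equalityI) (auto simp: len nth)
    moreover have "track y = (\<lambda>k. if k \<in> K0 then track y k else track x k)"
    proof
      fix k
      have "k \<in> snd (y ! p) \<longleftrightarrow> k \<in> snd (x ! p)" if "p < length x" "k \<notin> K0" for p
        using nth(2)[OF that(1)] that(2) by blast
      then show "track y k = (if k \<in> K0 then track y k else track x k)"
        by (auto simp: track_def len)
    qed
    ultimately show ?R
      using y(3) len by (intro exI[of _ "track y"]) (auto simp: track_def)
  next
    assume ?R
    then obtain J where J: "\<And>k. J k \<subseteq> {..<length x}"
      and Q: "Q (map fst x) (\<lambda>k. if k \<in> K0 then J k else track x k)"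
      by auto
    \<comment> \<open>The given word with its \<open>K0\<close> tracks overwritten by
      \<open>J\<close>.\<close>
    define y where "y = map (\<lambda>p. (fst (x ! p), {k \<in> K0. p \<in> J k} \<union> (snd (x ! p) - K0))) [0..<length x]"
    have xp: "x ! p \<in> ?\<Delta>" if "p < length x" for p
      using x that nth_mem by auto
    have "y \<in> lists ?\<Delta>"
      unfolding y_def using xp assms(2) by (fastforce simp: mem_Times_iff)
    moreover have "map h y = map h x"
      by (rule nth_equalityI) (auto simp: y_def h_def split: prod.splits)
    moreover have "map fst y = map fst x"
      by (rule nth_equalityI) (auto simp: y_def)
    moreover have "track y = (\<lambda>k. if k \<in> K0 then J k else track x k)"
    proof
      fix k
      show "track y k = (if k \<in> K0 then J k else track x k)"
        using J[of k] by (auto simp: track_def y_def)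
    qed
    ultimately show ?L
      using Q by auto
  qed
  show ?thesis
    using regular_projection[OF assms(1)[unfolded mso_def], of "\<Gamma> \<times> Pow K" h h]
    unfolding mso_def by (subst regular_cong[OF eq[symmetric]])
qed

text \<open>The bound set enters \<open>Q\<close> as a separate argument, and the variable
  \<open>k\<close> merely stores it. The assumption \<open>fresh\<close> is the semantic form of
  saying that \<open>k\<close> does not occur free in \<open>Q\<close>.\<close>

lemma mso_ex_set:
  assumes "mso \<Gamma> K (\<lambda>w I. Q w I (I k))" "k \<in> K"
    and fresh: "\<And>w I A B. Q w (I(k := A)) B = Q w I B"
  shows "mso \<Gamma> K (\<lambda>w I. \<exists>A\<subseteq>{..<length w}. Q w I A)"
proof -
  have eq: "(\<exists>A\<subseteq>{..<length w}. Q w I A) \<longleftrightarrow>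
      (\<exists>J. (\<forall>k. J k \<subseteq> {..<length w}) \<and> Q w (\<lambda>i. if i \<in> {k} then J i else I i) (if k \<in> {k} then J k else I k))"
    for w :: "'a list" and I
  proof -
    have *: "(\<lambda>i. if i \<in> {k} then J i else I i) = I(k := J k)" for J
      by (simp add: fun_eq_iff)
    show ?thesis
      unfolding * fresh by (auto intro: exI[of _ "\<lambda>_. _"])
  qed
  show ?thesis
    unfolding eq by (rule mso_ex_family[OF assms(1)]) (use assms(2) in auto)
qed

text \<open>The condition that the defining predicate fails on the empty set keeps the value of a
  set term within the positions of the word.\<close>

definition set_term :: "(('n \<Rightarrow> nat set) \<Rightarrow> nat set) \<Rightarrow> bool" where
  "set_term A \<longleftrightarrow> (\<exists>\<phi>. \<not> \<phi> {} \<and> (\<forall>I p. p \<in> A I \<longleftrightarrow> \<phi> {k. p \<in> I k}))"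

lemma set_term_var: "set_term (\<lambda>I. I k)"
  unfolding set_term_def by (rule exI[of _ "\<lambda>N. k \<in> N"]) auto

lemma set_term_empty: "set_term (\<lambda>I. {})"
  unfolding set_term_def by auto

lemma set_term_diff:
  assumes "set_term A" "set_term B"
  shows "set_term (\<lambda>I. A I - B I)"
proof -
  obtain \<phi> \<psi> where "\<not> \<phi> {}" "\<And>I p. p \<in> A I \<longleftrightarrow> \<phi> {k. p \<in> I k}" "\<And>I p. p \<in> B I \<longleftrightarrow> \<psi> {k. p \<in> I k}"
    using assms unfolding set_term_def by metis
  then show ?thesis
    unfolding set_term_def by (intro exI[of _ "\<lambda>N. \<phi> N \<and> \<not> \<psi> N"]) auto
qed

lemma set_term_if: "set_term A \<Longrightarrow> set_term B \<Longrightarrow> set_term (\<lambda>I. if b then A I else B I)"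
  by (cases b) simp_all

lemmas set_term_intros = set_term_var set_term_empty set_term_diff set_term_if

lemma set_term_track:
  assumes "set_term A"
  obtains \<phi> where "\<And>x p. p \<in> A (track x) \<longleftrightarrow> p < length x \<and> \<phi> (snd (x ! p))"
proof -
  obtain \<phi> where \<phi>: "\<not> \<phi> {}" "\<And>I p. p \<in> A I \<longleftrightarrow> \<phi> {k. p \<in> I k}"
    using assms unfolding set_term_def by metis
  have "p \<in> A (track x) \<longleftrightarrow> p < length x \<and> \<phi> (snd (x ! p))" for x p
    by (cases "p < length x") (auto simp: \<phi> track_def)
  then show ?thesis
    using that by blast
qed

section \<open>Atomic properties of sets of positions\<close>

lemma mso_empty:
  fixes \<Gamma> :: "'c set" and K :: "'n set"
  assumes "set_term A"
  shows "mso \<Gamma> K (\<lambda>w I. A I = {})"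
proof -
  obtain \<phi> where \<phi>: "\<And>(x :: ('c \<times> 'n set) list) p. p \<in> A (track x) \<longleftrightarrow> p < length x \<and> \<phi> (snd (x ! p))"
    using set_term_track[OF assms] by metis
  have "A (track x) = {} \<longleftrightarrow> \<not> (\<exists>c\<in>set x. \<phi> (snd c))" for x :: "('c \<times> 'n set) list"
  proof -
    have "(\<exists>c\<in>set x. \<phi> (snd c)) \<longleftrightarrow> (\<exists>p<length x. \<phi> (snd (x ! p)))"
      by (metis in_set_conv_nth)
    then show ?thesis
      by (simp only: set_eq_iff \<phi>) blast
  qed
  then show ?thesis
    unfolding mso_def by (simp only:) (intro regular_not regular_ex_letter)
qed

lemma mso_subset: "set_term A \<Longrightarrow> set_term B \<Longrightarrow> mso \<Gamma> K (\<lambda>w I. A I \<subseteq> B I)"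
  unfolding Diff_eq_empty_iff[symmetric] by (intro mso_empty set_term_diff)

lemma mso_disjoint:
  assumes "set_term A" "set_term B"
  shows "mso \<Gamma> K (\<lambda>w I. A I \<inter> B I = {})"
proof -
  have *: "A I \<inter> B I = {} \<longleftrightarrow> A I \<subseteq> A I - B I" for I
    by auto
  show ?thesis
    unfolding * by (intro mso_subset set_term_diff assms)
qed

lemma mso_psubset: "set_term A \<Longrightarrow> set_term B \<Longrightarrow> mso \<Gamma> K (\<lambda>w I. A I \<subset> B I)"
  unfolding subset_not_subset_eq by (intro mso_conj mso_not mso_subset)

text \<open>The negation forbids certain combinations of an earlier and a later annotated letter,
  which is an instance of \<open>sorted_wrt\<close>.\<close>

lemma mso_distant_pair:
  fixes \<Gamma> :: "'c set" and K :: "'n set"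
  assumes "set_term A" "set_term B" "finite \<Gamma>" "finite K"
  shows "mso \<Gamma> K (\<lambda>w I. \<exists>p\<in>A I. \<exists>q\<in>B I. p < q \<and> R (w ! p) (w ! q))"
proof -
  obtain \<phi> \<psi> where \<phi>: "\<And>(x :: ('c \<times> 'n set) list) p. p \<in> A (track x) \<longleftrightarrow> p < length x \<and> \<phi> (snd (x ! p))"
    and \<psi>: "\<And>(x :: ('c \<times> 'n set) list) p. p \<in> B (track x) \<longleftrightarrow> p < length x \<and> \<psi> (snd (x ! p))"
    using set_term_track[OF assms(1)] set_term_track[OF assms(2)] by metis
  let ?R = "\<lambda>c d. \<not> (\<phi> (snd c) \<and> \<psi> (snd d) \<and> R (fst c) (fst d))"
  have "(\<exists>p\<in>A (track x). \<exists>q\<in>B (track x). p < q \<and> R (map fst x ! p) (map fst x ! q)) \<longleftrightarrow>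
      \<not> sorted_wrt ?R x" for x :: "('c \<times> 'n set) list"
    unfolding sorted_wrt_iff_nth_less Bex_def \<phi> \<psi>
    by (simp cong: conj_cong) (blast intro: less_trans)
  then show ?thesis
    unfolding mso_def by (simp only:) (intro regular_not regular_sorted_wrt, use assms(3,4) in simp)
qed

text \<open>The negation is again a pairwise condition, now on neighbouring letters only, hence
  \<open>successively\<close>.\<close>

lemma mso_consecutive_pair:
  fixes \<Gamma> :: "'c set" and K :: "'n set"
  assumes "set_term A" "set_term B" "finite \<Gamma>" "finite K"
  shows "mso \<Gamma> K (\<lambda>w I. \<exists>p\<in>A I. Suc p \<in> B I \<and> R (w ! p) (w ! Suc p))"
proof -
  obtain \<phi> \<psi> where \<phi>: "\<And>(x :: ('c \<times> 'n set) list) p. p \<in> A (track x) \<longleftrightarrow> p < length x \<and> \<phi> (snd (x ! p))"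
    and \<psi>: "\<And>(x :: ('c \<times> 'n set) list) p. p \<in> B (track x) \<longleftrightarrow> p < length x \<and> \<psi> (snd (x ! p))"
    using set_term_track[OF assms(1)] set_term_track[OF assms(2)] by metis
  let ?R = "\<lambda>c d. \<not> (\<phi> (snd c) \<and> \<psi> (snd d) \<and> R (fst c) (fst d))"
  have "(\<exists>p\<in>A (track x). Suc p \<in> B (track x) \<and> R (map fst x ! p) (map fst x ! Suc p)) \<longleftrightarrow>
      \<not> successively ?R x" for x :: "('c \<times> 'n set) list"
    unfolding successively_conv_nth Bex_def \<phi> \<psi>
    by (simp cong: conj_cong) (blast dest: Suc_lessD)
  then show ?thesis
    unfolding mso_def by (simp only:) (intro regular_not regular_successively, use assms(3,4) in simp)
qed

lemma mso_singleton:
  assumes "set_term A" "finite \<Gamma>" "finite K"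
  shows "mso \<Gamma> K (\<lambda>w I. is_singleton (A I))"
proof -
  \<comment> \<open>The conjunct \<open>True\<close> makes the right-hand side an instance of
    \<open>mso_distant_pair\<close> with the trivial relation.\<close>
  have *: "is_singleton X \<longleftrightarrow> X \<noteq> {} \<and> \<not> (\<exists>p\<in>X. \<exists>q\<in>X. p < q \<and> True)" for X :: "nat set"
  proof
    assume "is_singleton X"
    then show "X \<noteq> {} \<and> \<not> (\<exists>p\<in>X. \<exists>q\<in>X. p < q \<and> True)"
      by (auto elim!: is_singletonE)
  next
    assume "X \<noteq> {} \<and> \<not> (\<exists>p\<in>X. \<exists>q\<in>X. p < q \<and> True)"
    then show "is_singleton X"
      by (intro is_singletonI') (auto simp: not_less intro: antisym)
  qed
  show ?thesis
    unfolding * by (intro mso_conj mso_not mso_empty mso_distant_pair assms)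
qed

definition touch :: "('w \<Rightarrow> 'w \<Rightarrow> bool) \<Rightarrow> 'w set \<Rightarrow> 'w set \<Rightarrow> bool" where
  "touch E A B \<longleftrightarrow> (\<exists>p\<in>A. \<exists>q\<in>B. E p q)"

text \<open>The graph on the positions of a word: far relates the letters at two positions that are
  adjacent irrespective of their distance, near those at consecutive adjacent positions.\<close>

definition word_adj :: "('c \<Rightarrow> 'c \<Rightarrow> bool) \<Rightarrow> ('c \<Rightarrow> 'c \<Rightarrow> bool) \<Rightarrow> 'c list \<Rightarrow> nat \<Rightarrow> nat \<Rightarrow> bool" where
  "word_adj far near w p q \<longleftrightarrow>
     p \<noteq> q \<and> far (w ! p) (w ! q) \<or> q = Suc p \<and> near (w ! p) (w ! q) \<or> p = Suc q \<and> near (w ! q) (w ! p)"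

lemma word_adj_sym: "symp far \<Longrightarrow> word_adj far near w p q = word_adj far near w q p"
  unfolding word_adj_def by (auto dest: sympD)

text \<open>Sorting the edges by which end comes first reduces the claim to ordered pairs of
  positions; symmetry of \<open>far\<close> allows such a pair to be read in either
  direction.\<close>

lemma mso_touch:
  assumes "set_term A" "set_term B" "finite \<Gamma>" "finite K" "symp far"
  shows "mso \<Gamma> K (\<lambda>w I. touch (word_adj far near w) (A I) (B I))"
proof -
  have *: "touch (word_adj far near w) X Y \<longleftrightarrow>
      (\<exists>p\<in>X. \<exists>q\<in>Y. p < q \<and> far (w ! p) (w ! q)) \<or> (\<exists>p\<in>Y. \<exists>q\<in>X. p < q \<and> far (w ! p) (w ! q)) \<or>
      (\<exists>p\<in>X. Suc p \<in> Y \<and> near (w ! p) (w ! Suc p)) \<or> (\<exists>p\<in>Y. Suc p \<in> X \<and> near (w ! p) (w ! Suc p))"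
    for w :: "'b list" and X Y
    unfolding touch_def word_adj_def using sympD[OF assms(5)] by (auto simp: nat_neq_iff; blast)
  show ?thesis
    unfolding * by (intro mso_disj mso_distant_pair mso_consecutive_pair assms)
qed

section \<open>Induced paths as minimal connecting sets\<close>

text \<open>Reachability of \<open>B\<close> from \<open>A\<close> in the graph induced on
  \<open>X\<close>, phrased through closed sets \<open>Z\<close> so that only set quantifiers occur.
  Taking \<open>Z = X\<close> shows that \<open>B\<close> lies in \<open>X\<close>. The ends are
  sets because they become values of set variables.\<close>

definition connects :: "('w \<Rightarrow> 'w \<Rightarrow> bool) \<Rightarrow> 'w set \<Rightarrow> 'w set \<Rightarrow> 'w set \<Rightarrow> bool" where
  "connects E X A B \<longleftrightarrow> A \<subseteq> X \<and> (\<forall>Z\<subseteq>X. A \<subseteq> Z \<and> \<not> touch E Z (X - Z) \<longrightarrow> B \<subseteq> Z)"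

definition induced_path :: "('w \<Rightarrow> 'w \<Rightarrow> bool) \<Rightarrow> 'w set \<Rightarrow> 'w set \<Rightarrow> 'w set \<Rightarrow> bool" where
  "induced_path E X A B \<longleftrightarrow> connects E X A B \<and> (\<forall>Y\<subset>X. \<not> connects E Y A B)"

text \<open>Numbering from 1 matches the interior vertices of an urpath. The case
  \<open>m = 1\<close> with \<open>a = b\<close> is an urpath with a single interior vertex.\<close>

definition path_enum :: "('w \<Rightarrow> 'w \<Rightarrow> bool) \<Rightarrow> 'w set \<Rightarrow> 'w \<Rightarrow> 'w \<Rightarrow> nat \<Rightarrow> (nat \<Rightarrow> 'w) \<Rightarrow> bool" where
  "path_enum E X a b m g \<longleftrightarrow> 1 \<le> m \<and> bij_betw g {1..m} X \<and> g 1 = a \<and> g m = b \<and>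
     (\<forall>i\<in>{1..m}. \<forall>j\<in>{1..m}. E (g i) (g j) \<longleftrightarrow> i = Suc j \<or> j = Suc i)"

lemma path_enum_connects:
  assumes "path_enum E X a b m g"
  shows "connects E X {a} {b}"
proof -
  have m: "1 \<le> m" and bij: "bij_betw g {1..m} X" and ab: "g 1 = a" "g m = b"
    and E: "\<And>i. 1 \<le> i \<Longrightarrow> i < m \<Longrightarrow> E (g i) (g (Suc i))"
    using assms by (auto simp: path_enum_def)
  have X: "g i \<in> X" if "1 \<le> i" "i \<le> m" for i
    using bij that by (auto simp: bij_betw_def)
  have "b \<in> Z" if Z: "Z \<subseteq> X" "a \<in> Z" "\<not> touch E Z (X - Z)" for Z
  proof -
    have "i \<le> m \<longrightarrow> g i \<in> Z" if "1 \<le> i" for i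
      using that
    proof (induction i rule: dec_induct)
      case base
      then show ?case
        using Z ab by simp
    next
      case (step i)
      show ?case
      proof
        assume "Suc i \<le> m"
        then have "g i \<in> Z" "E (g i) (g (Suc i))" "g (Suc i) \<in> X"
          using step E X by auto
        then show "g (Suc i) \<in> Z"
          using Z(3) unfolding touch_def by blast
      qed
    qed
    then show ?thesis
      using m ab by auto
  qed
  then show ?thesis
    unfolding connects_def using X[of 1] m ab by auto
qed

text \<open>A missing vertex cuts the path: what \<open>Y\<close> retains before it is closed in
  \<open>Y\<close> and contains \<open>a\<close> but not \<open>b\<close>.\<close>

lemma path_enum_minimal:
  assumes "path_enum E X a b m g" "Y \<subset> X"
  shows "\<not> connects E Y {a} {b}"
proof
  assume conn: "connects E Y {a} {b}"
  have m: "1 \<le> m" and bij: "bij_betw g {1..m} X" and ab: "g 1 = a" "g m = b"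
    and E: "\<And>i j. i \<in> {1..m} \<Longrightarrow> j \<in> {1..m} \<Longrightarrow> E (g i) (g j) \<longleftrightarrow> i = Suc j \<or> j = Suc i"
    using assms(1) by (auto simp: path_enum_def)
  obtain x where "x \<in> X" "x \<notin> Y"
    using assms(2) by blast
  then obtain k where k: "k \<in> {1..m}" "g k \<notin> Y"
    using bij by (auto simp: bij_betw_def)
  define Z where "Z = g ` {1..<k} \<inter> Y"
  have "a \<in> Y"
    using conn by (simp add: connects_def)
  then have "k \<noteq> 1"
    using k ab by auto
  then have "a \<in> Z"
    using k ab \<open>a \<in> Y\<close> unfolding Z_def by force
  moreover have "\<not> touch E Z (Y - Z)"
  proof
    assume "touch E Z (Y - Z)"
    then obtain z y where "z \<in> Z" and y: "y \<in> Y" "y \<notin> Z" "E z y"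
      unfolding touch_def by blast
    then obtain i where i: "1 \<le> i" "i < k" "z = g i"
      unfolding Z_def by auto
    have "y \<in> g ` {1..m}"
      using y assms(2) bij by (auto simp: bij_betw_def)
    then obtain j where j: "j \<in> {1..m}" "y = g j"
      by auto
    have "k \<le> j"
      using y j unfolding Z_def by (auto simp: not_le[symmetric])
    moreover have "j \<noteq> k"
      using k y j by auto
    ultimately show False
      using E[of i j] i j k y by auto
  qed
  ultimately have "b \<in> Z"
    using conn[unfolded connects_def, THEN conjunct2, rule_format, of Z] by (simp add: Z_def)
  then obtain i where "1 \<le> i" "i < k" "g i = g m"
    unfolding Z_def ab[symmetric] by auto
  moreover have "inj_on g {1..m}"
    using bij by (simp add: bij_betw_def)
  ultimately show False
    using k by (auto dest: inj_onD[of g _ i m])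
qed

text \<open>A shortest walk from \<open>a\<close> to \<open>b\<close> inside \<open>X\<close>
  repeats no vertex and has no chord, so its vertices induce a path.\<close>

lemma connects_imp_path_enum:
  assumes sym: "\<And>p q. E p q = E q p" and irrefl: "\<And>p. \<not> E p p"
    and conn: "connects E X {a} {b}"
  obtains m g Y where "Y \<subseteq> X" "path_enum E Y a b m g"
proof -
  define R where "R = {(p, q). p \<in> X \<and> q \<in> X \<and> E p q}"
  have aX: "a \<in> X"
    using conn by (simp add: connects_def)
  \<comment> \<open>The part of \<open>X\<close> reachable from \<open>a\<close> is closed, so the
    hypothesis puts \<open>b\<close> into it.\<close>
  let ?Z = "{q \<in> X. (a, q) \<in> R\<^sup>*}"
  have "\<not> touch E ?Z (X - ?Z)"
  proof
    assume "touch E ?Z (X - ?Z)"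
    then obtain p q where "p \<in> X" "(a, p) \<in> R\<^sup>*" "q \<in> X" "(a, q) \<notin> R\<^sup>*" "E p q"
      unfolding touch_def by blast
    moreover from this have "(p, q) \<in> R"
      by (simp add: R_def)
    ultimately show False
      using rtrancl_into_rtrancl[of a p R q] by simp
  qed
  then have "b \<in> ?Z"
    using conn[unfolded connects_def, THEN conjunct2, rule_format, of ?Z] aX by simp
  then obtain n0 where "(a, b) \<in> R ^^ n0"
    by (auto dest: rtrancl_imp_relpow)
  define n where "n = (LEAST n. (a, b) \<in> R ^^ n)"
  have n: "(a, b) \<in> R ^^ n"
    unfolding n_def by (rule LeastI[of _ n0]) fact
  have least: "n \<le> k" if "(a, b) \<in> R ^^ k" for k
    unfolding n_def by (rule Least_le) fact
  obtain f where f: "f 0 = a" "f n = b" "\<And>i. i < n \<Longrightarrow> (f i, f (Suc i)) \<in> R"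
    using n unfolding relpow_fun_conv by auto
  have walk: "(f i, f j) \<in> R ^^ (j - i)" if "i \<le> j" "j \<le> n" for i j
    unfolding relpow_fun_conv by (rule exI[of _ "\<lambda>k. f (i + k)"]) (use that f(3) in auto)
  have fX: "f i \<in> X" if "i \<le> n" for i
    using f(1) f(3)[of "i - 1"] that aX by (cases i) (auto simp: R_def)
  \<comment> \<open>A detour of length \<open>k\<close> from \<open>f i\<close> to
    \<open>f j\<close>, spliced into the shortest walk, gives a walk of length
    \<open>i + k + (n - j)\<close>, which is at least \<open>n\<close>. The case
    \<open>k = 0\<close> yields injectivity, and \<open>k = 1\<close> excludes chords.\<close>
  have shortcut: "j \<le> i + k" if "i \<le> n" "j \<le> n" "(f i, f j) \<in> R ^^ k" for i j k
  proof -
    have "(a, f j) \<in> R ^^ (i + k)"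
      using walk[of 0 i] that f(1) by (auto simp: relpow_add)
    then have "(a, b) \<in> R ^^ (i + k + (n - j))"
      using walk[of j n] that f(2) relpow_add by (metis relcomp.relcompI order_refl)
    then show ?thesis
      using least that by fastforce
  qed
  have inj: "inj_on f {0..n}"
  proof (rule inj_onI)
    fix i j assume "i \<in> {0..n}" "j \<in> {0..n}" "f i = f j"
    then show "i = j"
      using shortcut[of i j 0] shortcut[of j i 0] by auto
  qed
  have adj: "E (f i) (f j) \<longleftrightarrow> i = Suc j \<or> j = Suc i" if "i \<le> n" "j \<le> n" for i j
  proof
    assume E: "E (f i) (f j)"
    then have "i \<noteq> j"
      using irrefl by auto
    have "(f i, f j) \<in> R ^^ 1" "(f j, f i) \<in> R ^^ 1"
      using E sym fX that by (auto simp: R_def)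
    then have "j \<le> i + 1" "i \<le> j + 1"
      using shortcut that by blast+
    with \<open>i \<noteq> j\<close> show "i = Suc j \<or> j = Suc i"
      by auto
  next
    assume "i = Suc j \<or> j = Suc i"
    then show "E (f i) (f j)"
      using f(3)[of i] f(3)[of j] that sym by (auto simp: R_def)
  qed
  show ?thesis
  proof
    show "f ` {0..n} \<subseteq> X"
      using fX by auto
    \<comment> \<open>The walk \<open>f\<close> counts from 0, while \<open>path_enum\<close> counts
      from 1.\<close>
    have "bij_betw (\<lambda>i. i - 1) {1..Suc n} {0..n}"
      by (rule bij_betw_byWitness[where f' = Suc]) auto
    then have "bij_betw (\<lambda>i. f (i - 1)) {1..Suc n} (f ` {0..n})"
      using bij_betw_trans[of "\<lambda>i. i - 1" _ _ f] inj by (auto simp: bij_betw_def comp_def)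
    then show "path_enum E (f ` {0..n}) a b (Suc n) (\<lambda>i. f (i - 1))"
      unfolding path_enum_def using f(1,2) by (auto simp: adj)
  qed
qed

text \<open>A connecting set includes the vertex set of an induced path, which already connects; a
  minimal connecting set must therefore equal it.\<close>

lemma induced_path_iff:
  assumes "\<And>p q. E p q = E q p" "\<And>p. \<not> E p p"
  shows "induced_path E X {a} {b} \<longleftrightarrow> (\<exists>m g. path_enum E X a b m g)"
proof
  assume ip: "induced_path E X {a} {b}"
  then have "connects E X {a} {b}"
    by (simp add: induced_path_def)
  then obtain m g Y where "Y \<subseteq> X" "path_enum E Y a b m g"
    by (rule connects_imp_path_enum[OF assms])
  moreover from this have "Y = X"
    using ip path_enum_connects[of E Y a b m g] by (auto simp: induced_path_def)
  ultimately show "\<exists>m g. path_enum E X a b m g"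
    by auto
next
  assume "\<exists>m g. path_enum E X a b m g"
  then show "induced_path E X {a} {b}"
    unfolding induced_path_def by (auto dest: path_enum_connects path_enum_minimal)
qed

section \<open>Containment of a pathograph as a monadic second-order property\<close>

lemma realization_edge_vertices:
  fixes P :: "('a, 'b) pathograph"
  assumes "is_realization P lft rgt m EG"
  shows "{Inl a, Inl a'} \<in> EG \<longleftrightarrow> {a, a'} \<in> pE P"
proof
  assume "{Inl a, Inl a'} \<in> EG"
  then have "{Inl a, Inl a'} \<in> (image Inl) ` pE P \<union> (\<Union>u \<in> pU P. path_edges lft rgt m u)
            \<union> spoke_edges P m \<union> rung_edges P m"
    using assms unfolding is_realization_def by blast
  then obtain e where "e \<in> pE P" "(Inl ` {a, a'} :: ('a + 'b \<times> nat) set) = Inl ` e"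
    by (auto simp: path_edges_def spoke_edges_def rung_edges_def internal_def doubleton_eq_iff)
  then show "{a, a'} \<in> pE P"
    by (metis inj_Inl inj_image_eq_iff)
next
  assume "{a, a'} \<in> pE P"
  then have "(Inl ` {a, a'} :: ('a + 'b \<times> nat) set) \<in> (image Inl) ` pE P"
    by (rule imageI)
  moreover have "(image Inl) ` pE P \<subseteq> EG"
    using assms by (simp add: is_realization_def)
  ultimately have "(Inl ` {a, a'} :: ('a + 'b \<times> nat) set) \<in> EG"
    by (rule rev_subsetD)
  then show "{Inl a, Inl a'} \<in> EG"
    by simp
qed

text \<open>An end of an urpath without a spoke to it still meets the interior vertex next to it.
  This exception is the reason for the exempted sets \<open>A\<close> and \<open>B\<close> in
  \<open>embedding\<close>.\<close>

lemma realization_edge_spoke: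
  assumes "is_realization P lft rgt m EG" "{Inl a, Inr (b, j)} \<in> EG"
  shows "(a, b) \<in> pS P \<or> a = lft b \<and> j = 1 \<or> a = rgt b \<and> j = m b"
proof -
  have "{Inl a, Inr (b, j)} \<in> (image Inl) ` pE P \<union> (\<Union>u \<in> pU P. path_edges lft rgt m u)
            \<union> spoke_edges P m \<union> rung_edges P m"
    using assms unfolding is_realization_def by blast
  then show ?thesis
    by (auto simp: path_edges_def spoke_edges_def rung_edges_def internal_def doubleton_eq_iff)
qed

lemma realization_edge_path:
  assumes "is_realization P lft rgt m EG" "b \<in> pU P" "i \<in> {1..m b}" "j \<in> {1..m b}"
  shows "{Inr (b, i), Inr (b, j)} \<in> EG \<longleftrightarrow> i = Suc j \<or> j = Suc i"
proof
  assume "{Inr (b, i), Inr (b, j)} \<in> EG"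
  then have "{Inr (b, i), Inr (b, j)} \<in> (image Inl) ` pE P \<union> (\<Union>u \<in> pU P. path_edges lft rgt m u)
            \<union> spoke_edges P m \<union> rung_edges P m"
    using assms unfolding is_realization_def by blast
  then show "i = Suc j \<or> j = Suc i"
    by (auto simp: path_edges_def spoke_edges_def rung_edges_def internal_def doubleton_eq_iff)
next
  assume "i = Suc j \<or> j = Suc i"
  then have "{Inr (b, i), Inr (b, j)} \<in> path_edges lft rgt m b"
    using assms(3,4) by (auto simp: path_edges_def doubleton_eq_iff)
  then show "{Inr (b, i), Inr (b, j)} \<in> EG"
    using assms(1,2) unfolding is_realization_def by blast
qed

lemma realization_edge_rung:
  assumes "is_realization P lft rgt m EG" "{Inr (b, i), Inr (b', j)} \<in> EG" "b \<noteq> b'"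
  shows "{b, b'} \<in> pR P"
proof -
  have "{Inr (b, i), Inr (b', j)} \<in> (image Inl) ` pE P \<union> (\<Union>u \<in> pU P. path_edges lft rgt m u)
            \<union> spoke_edges P m \<union> rung_edges P m"
    using assms unfolding is_realization_def by blast
  then show ?thesis
    using assms(3)
    by (auto simp: path_edges_def spoke_edges_def rung_edges_def internal_def doubleton_eq_iff insert_commute)
qed

text \<open>J assigns to each vertex and urpath of F the set of host vertices that play its role (its
  interior, for an urpath); A and B hold the first and the last interior vertex of an urpath.\<close>

definition embedding :: "('w \<Rightarrow> 'w \<Rightarrow> bool) \<Rightarrow> ('a, 'b) pathograph \<Rightarrow> ('a + 'b \<Rightarrow> 'w set) \<Rightarrow> bool" where
  "embedding E F J \<longleftrightarrow>
     (\<forall>a\<in>pV F. is_singleton (J (Inl a))) \<and>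
     (\<forall>k\<in>pV F <+> pU F. \<forall>k'\<in>pV F <+> pU F. k \<noteq> k' \<longrightarrow> J k \<inter> J k' = {}) \<and>
     (\<forall>a\<in>pV F. \<forall>a'\<in>pV F. a \<noteq> a' \<longrightarrow> (touch E (J (Inl a)) (J (Inl a')) \<longleftrightarrow> {a, a'} \<in> pE F)) \<and>
     (\<forall>b\<in>pU F. \<exists>s\<in>pV F. \<exists>t\<in>pV F. pEnds F b = {s, t} \<and>
        (\<exists>A\<subseteq>J (Inr b). \<exists>B\<subseteq>J (Inr b). is_singleton A \<and> is_singleton B \<and>
           induced_path E (J (Inr b)) A B \<and> touch E (J (Inl s)) A \<and> touch E (J (Inl t)) B \<and>
           (\<forall>a\<in>pV F. (a, b) \<notin> pS F \<longrightarrow>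
              \<not> touch E (J (Inl a)) (J (Inr b) - (if a = s then A else if a = t then B else {}))))) \<and>
     (\<forall>(a, b)\<in>pS F. touch E (J (Inl a)) (J (Inr b))) \<and>
     (\<forall>b\<in>pU F. \<forall>b'\<in>pU F. b \<noteq> b' \<longrightarrow> (touch E (J (Inr b)) (J (Inr b')) \<longleftrightarrow> {b, b'} \<in> pR F))"

lemma doubleton_in_edges_iff:
  assumes "\<And>p q. E p q = E q p"
  shows "{p, q} \<in> {{p, q} |p q. E p q} \<longleftrightarrow> E p q"
  using assms by (auto simp: doubleton_eq_iff)

text \<open>The role of each vertex or urpath is the image of its part of the canonical realization.
  Indices outside F get the empty set, so that the family is determined by finitely many
  tracks.\<close>

lemma contains_imp_embedding:
  fixes F :: "('a, 'b) pathograph" and E :: "'w \<Rightarrow> 'w \<Rightarrow> bool"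
  assumes wf: "wf_pathograph F" and sym: "\<And>p q. E p q = E q p" and irrefl: "\<And>p. \<not> E p p"
    and "contains_pathograph V {{p, q} |p q. E p q} F"
  shows "\<exists>J. (\<forall>k. J k \<subseteq> V) \<and> (\<forall>k. k \<notin> pV F <+> pU F \<longrightarrow> J k = {}) \<and> embedding E F J"
proof -
  obtain lft rgt m ER f where real: "is_realization F lft rgt m ER" and inj: "inj_on f (real_vertices F m)"
    and V: "f ` real_vertices F m \<subseteq> V"
    and E': "\<And>x y. \<lbrakk>x \<in> real_vertices F m; y \<in> real_vertices F m; x \<noteq> y\<rbrakk> \<Longrightarrow> {x, y} \<in> ER \<longleftrightarrow> E (f x) (f y)"
    using assms(4) unfolding contains_pathograph_def doubleton_in_edges_iff[of E, OF sym] by metis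
  define J where "J k = f ` (case k of Inl a \<Rightarrow> if a \<in> pV F then {Inl a} else {}
      | Inr b \<Rightarrow> if b \<in> pU F then internal m b else {})" for k
  have Jv: "J (Inl a) = {f (Inl a)}" if "a \<in> pV F" for a
    using that by (simp add: J_def)
  have Ju: "J (Inr b) = f ` internal m b" if "b \<in> pU F" for b
    using that by (simp add: J_def)
  have Rv: "Inl a \<in> real_vertices F m" if "a \<in> pV F" for a
    using that by (simp add: real_vertices_def)
  have Ru: "Inr (b, j) \<in> real_vertices F m" if "b \<in> pU F" "j \<in> {1..m b}" for b j
    using that by (auto simp: real_vertices_def internal_def)
  have m: "1 \<le> m b" and ends: "pEnds F b = {lft b, rgt b}" if "b \<in> pU F" for b
    using that real unfolding is_realization_def by auto
  have int: "internal m b = (\<lambda>j. Inr (b, j)) ` {1..m b}" for b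
    by (auto simp: internal_def)
  have endsV: "lft b \<in> pV F" "rgt b \<in> pV F" "lft b \<noteq> rgt b" if "b \<in> pU F" for b
  proof -
    have "{lft b, rgt b} \<in> doubletons (pV F)"
      using that wf ends unfolding wf_pathograph_def by metis
    then show "lft b \<in> pV F" "rgt b \<in> pV F" "lft b \<noteq> rgt b"
      by (auto simp: doubletons_def doubleton_eq_iff)
  qed
  have S: "a \<in> pV F" "b \<in> pU F" if "(a, b) \<in> pS F" for a b
    using that wf unfolding wf_pathograph_def by auto
  have path_edge: "e \<in> ER" if "b \<in> pU F" "e \<in> path_edges lft rgt m b" for b e
    using that real unfolding is_realization_def by blast
  have "embedding E F J"
    unfolding embedding_def
  proof (intro conjI ballI impI)
    fix a assume "a \<in> pV F"
    then show "is_singleton (J (Inl a))"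
      by (simp add: Jv)
  next
    fix k k' assume k: "k \<in> pV F <+> pU F" "k' \<in> pV F <+> pU F" "k \<noteq> k'"
    \<comment> \<open>\<open>C k\<close> is the part belonging to \<open>k\<close> before
      \<open>f\<close> is applied; injectivity of \<open>f\<close> carries over its disjointness
      from the other parts.\<close>
    define C :: "'a + 'b \<Rightarrow> ('a + 'b \<times> nat) set" where
      "C = (\<lambda>k. case k of Inl a \<Rightarrow> if a \<in> pV F then {Inl a} else {} | Inr b \<Rightarrow> if b \<in> pU F then internal m b else {})"
    have J: "J k = f ` C k" for k
      by (simp add: J_def C_def)
    have "C k \<subseteq> real_vertices F m" "C k' \<subseteq> real_vertices F m"
      by (auto simp: C_def real_vertices_def split: sum.splits)
    moreover have "C k \<inter> C k' = {}"
      using k(3) by (auto simp: C_def internal_def split: sum.splits if_splits)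
    ultimately show "J k \<inter> J k' = {}"
      unfolding J by (metis inj inj_on_image_Int image_empty)
  next
    fix a a' assume "a \<in> pV F" "a' \<in> pV F" "a \<noteq> a'"
    then show "touch E (J (Inl a)) (J (Inl a')) \<longleftrightarrow> {a, a'} \<in> pE F"
      using E'[OF Rv Rv, of a a'] by (simp add: Jv touch_def realization_edge_vertices[OF real])
  next
    fix b assume b: "b \<in> pU F"
    let ?g = "\<lambda>j. f (Inr (b, j))"
    let ?A = "{?g 1}" and ?B = "{?g (m b)}"
    have "path_enum E (J (Inr b)) (?g 1) (?g (m b)) (m b) ?g"
      unfolding path_enum_def
    proof (intro conjI ballI)
      show "bij_betw ?g {1..m b} (J (Inr b))"
        unfolding bij_betw_def Ju[OF b] int using Ru[OF b] by (auto intro!: inj_onI dest: inj_onD[OF inj])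
    next
      fix i j assume ij: "i \<in> {1..m b}" "j \<in> {1..m b}"
      show "E (?g i) (?g j) \<longleftrightarrow> i = Suc j \<or> j = Suc i"
      proof (cases "i = j")
        case True
        then show ?thesis
          using irrefl by simp
      next
        case False
        then show ?thesis
          using E'[OF Ru[OF b ij(1)] Ru[OF b ij(2)]] realization_edge_path[OF real b ij] by simp
      qed
    qed (use m[OF b] in auto)
    then have ip: "induced_path E (J (Inr b)) ?A ?B"
      using induced_path_iff[of E, OF sym irrefl] by blast
    have "{Inl (lft b), Inr (b, 1)} \<in> ER"
      by (rule path_edge[OF b]) (simp add: path_edges_def)
    then have l: "touch E (J (Inl (lft b))) ?A"
      using E'[OF Rv[OF endsV(1)[OF b]] Ru[OF b, of 1]] m[OF b] by (simp add: touch_def Jv endsV b)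
    have "{Inl (rgt b), Inr (b, m b)} \<in> ER"
      by (rule path_edge[OF b]) (auto simp: path_edges_def insert_commute)
    then have r: "touch E (J (Inl (rgt b))) ?B"
      using E'[OF Rv[OF endsV(2)[OF b]] Ru[OF b, of "m b"]] m[OF b] by (simp add: touch_def Jv endsV b)
    have nt: "\<not> touch E (J (Inl a)) (J (Inr b) - (if a = lft b then ?A else if a = rgt b then ?B else {}))"
      if a: "a \<in> pV F" "(a, b) \<notin> pS F" for a
    proof
      assume "touch E (J (Inl a)) (J (Inr b) - (if a = lft b then ?A else if a = rgt b then ?B else {}))"
      then obtain j where j: "j \<in> {1..m b}" "E (f (Inl a)) (?g j)"
        "?g j \<notin> (if a = lft b then ?A else if a = rgt b then ?B else {})"
        unfolding touch_def Jv[OF a(1)] Ju[OF b] int by blast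
      then have "{Inl a, Inr (b, j)} \<in> ER"
        using E'[OF Rv[OF a(1)] Ru[OF b j(1)]] by simp
      then show False
        using realization_edge_spoke[OF real, of a b j] a j(3) endsV(3)[OF b] by (auto split: if_splits)
    qed
    have "?A \<subseteq> J (Inr b)" "?B \<subseteq> J (Inr b)"
      using m[OF b] by (auto simp: Ju b int)
    with l r ip nt show "\<exists>s\<in>pV F. \<exists>t\<in>pV F. pEnds F b = {s, t} \<and>
        (\<exists>A\<subseteq>J (Inr b). \<exists>B\<subseteq>J (Inr b). is_singleton A \<and> is_singleton B \<and>
           induced_path E (J (Inr b)) A B \<and> touch E (J (Inl s)) A \<and> touch E (J (Inl t)) B \<and>
           (\<forall>a\<in>pV F. (a, b) \<notin> pS F \<longrightarrow>
              \<not> touch E (J (Inl a)) (J (Inr b) - (if a = s then A else if a = t then B else {}))))"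
      by (intro bexI[of _ "lft b"] bexI[of _ "rgt b"] conjI exI[of _ ?A] exI[of _ ?B])
        (auto simp: ends b endsV simp del: Diff_iff)
  next
    fix ab assume "ab \<in> pS F"
    then obtain a b where ab: "ab = (a, b)" "(a, b) \<in> pS F"
      by (cases ab) auto
    then have "\<exists>x\<in>internal m b. {Inl a, x} \<in> ER"
      using real unfolding is_realization_def by fast
    then obtain j where j: "j \<in> {1..m b}" "{Inl a, Inr (b, j)} \<in> ER"
      unfolding int by blast
    then have "E (f (Inl a)) (f (Inr (b, j)))"
      using E'[OF Rv Ru] S[OF ab(2)] by blast
    then show "case ab of (a, b) \<Rightarrow> touch E (J (Inl a)) (J (Inr b))"
      using j(1) S[OF ab(2)] by (auto simp: ab touch_def Jv Ju int)
  next
    fix b b' assume b: "b \<in> pU F" "b' \<in> pU F" "b \<noteq> b'"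
    show "touch E (J (Inr b)) (J (Inr b')) \<longleftrightarrow> {b, b'} \<in> pR F"
    proof
      assume "touch E (J (Inr b)) (J (Inr b'))"
      then obtain i j where ij: "i \<in> {1..m b}" "j \<in> {1..m b'}" "E (f (Inr (b, i))) (f (Inr (b', j)))"
        unfolding touch_def Ju[OF b(1)] Ju[OF b(2)] int by blast
      then have "{Inr (b, i), Inr (b', j)} \<in> ER"
        using E'[OF Ru[OF b(1) ij(1)] Ru[OF b(2) ij(2)]] b(3) by simp
      then show "{b, b'} \<in> pR F"
        using realization_edge_rung[OF real _ b(3)] by blast
    next
      assume "{b, b'} \<in> pR F"
      then have "\<exists>x \<in> internal m b. \<exists>y \<in> internal m b'. {x, y} \<in> ER"
        using real b(3) unfolding is_realization_def by blast
      then obtain i j where ij: "i \<in> {1..m b}" "j \<in> {1..m b'}" "{Inr (b, i), Inr (b', j)} \<in> ER"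
        unfolding int by blast
      then have "E (f (Inr (b, i))) (f (Inr (b', j)))"
        using E'[OF Ru[OF b(1) ij(1)] Ru[OF b(2) ij(2)]] b(3) by simp
      then show "touch E (J (Inr b)) (J (Inr b'))"
        unfolding touch_def Ju[OF b(1)] Ju[OF b(2)] int using ij by blast
    qed
  qed
  moreover have "\<forall>k. J k \<subseteq> V"
    using V unfolding J_def real_vertices_def by (auto split: sum.splits if_splits)
  moreover have "\<forall>k. k \<notin> pV F <+> pU F \<longrightarrow> J k = {}"
    unfolding J_def by (auto split: sum.splits)
  ultimately show ?thesis
    by (intro exI[of _ J] conjI)
qed

text \<open>The edges of the realization are pulled back from the host graph along \<open>f\<close>,
  so \<open>f\<close> preserves and reflects adjacency by construction. The work lies in checking
  that all required edges and only permitted ones arise.\<close>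

lemma embedding_imp_contains:
  fixes F :: "('a, 'b) pathograph" and E :: "'w \<Rightarrow> 'w \<Rightarrow> bool"
  assumes wf: "wf_pathograph F" and sym: "\<And>p q. E p q = E q p" and irrefl: "\<And>p. \<not> E p p"
    and JV: "\<And>k. J k \<subseteq> V" and emb: "embedding E F J"
  shows "contains_pathograph V {{p, q} |p q. E p q} F"
proof -
  have singleton: "is_singleton (J (Inl a))" if "a \<in> pV F" for a
    using emb[unfolded embedding_def, THEN conjunct1] that by auto
  have disj: "k = k'" if "k \<in> pV F <+> pU F" "k' \<in> pV F <+> pU F" "x \<in> J k" "x \<in> J k'" for k k' x
    using emb[unfolded embedding_def, THEN conjunct2, THEN conjunct1] that by blast
  have edge: "touch E (J (Inl a)) (J (Inl a')) \<longleftrightarrow> {a, a'} \<in> pE F"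
    if "a \<in> pV F" "a' \<in> pV F" "a \<noteq> a'" for a a'
    using emb[unfolded embedding_def, THEN conjunct2, THEN conjunct2, THEN conjunct1] that by auto
  have spoke: "touch E (J (Inl a)) (J (Inr b))" if "(a, b) \<in> pS F" for a b
    using emb[unfolded embedding_def, THEN conjunct2, THEN conjunct2, THEN conjunct2, THEN conjunct2, THEN conjunct1] that by auto
  have rung: "touch E (J (Inr b)) (J (Inr b')) \<longleftrightarrow> {b, b'} \<in> pR F"
    if "b \<in> pU F" "b' \<in> pU F" "b \<noteq> b'" for b b'
    using emb[unfolded embedding_def, THEN conjunct2, THEN conjunct2, THEN conjunct2, THEN conjunct2, THEN conjunct2] that by auto
  have "\<exists>x. J (Inl a) = {x}" if "a \<in> pV F" for a
    using singleton[OF that] by (simp add: is_singleton_def)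
  then obtain pt where pt: "\<And>a. a \<in> pV F \<Longrightarrow> J (Inl a) = {pt a}"
    by metis
  have vv: "E (pt a) (pt a') \<longleftrightarrow> {a, a'} \<in> pE F" if "a \<in> pV F" "a' \<in> pV F" "a \<noteq> a'" for a a'
    using edge[OF that] that by (simp add: pt touch_def)
  \<comment> \<open>Collected in one predicate so that ends, length and enumeration can be chosen
    together for every urpath. The order of \<open>s\<close> and \<open>t\<close> fixes the
    direction of the path; \<open>pEnds\<close> itself is unordered.\<close>
  define good where "good b s t m g \<longleftrightarrow> s \<in> pV F \<and> t \<in> pV F \<and> pEnds F b = {s, t} \<and> path_enum E (J (Inr b)) (g 1) (g m) m g \<and>
      E (pt s) (g 1) \<and> E (pt t) (g m) \<and>
      (\<forall>a\<in>pV F. (a, b) \<notin> pS F \<longrightarrow> (\<forall>x\<in>J (Inr b). E (pt a) x \<longrightarrow> a = s \<and> x = g 1 \<or> a = t \<and> x = g m))"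
    for b s t and m :: nat and g
  have "\<exists>s t m g. good b s t m g"
    if b: "b \<in> pU F" for b
  proof -
    have "\<exists>s\<in>pV F. \<exists>t\<in>pV F. pEnds F b = {s, t} \<and>
        (\<exists>A\<subseteq>J (Inr b). \<exists>B\<subseteq>J (Inr b). is_singleton A \<and> is_singleton B \<and>
           induced_path E (J (Inr b)) A B \<and> touch E (J (Inl s)) A \<and> touch E (J (Inl t)) B \<and>
           (\<forall>a\<in>pV F. (a, b) \<notin> pS F \<longrightarrow>
              \<not> touch E (J (Inl a)) (J (Inr b) - (if a = s then A else if a = t then B else {}))))"
      using b by (rule emb[unfolded embedding_def, THEN conjunct2, THEN conjunct2, THEN conjunct2, THEN conjunct1, rule_format])
    then obtain s t A B where st: "s \<in> pV F" "t \<in> pV F" "pEnds F b = {s, t}"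
      and AB: "is_singleton A" "is_singleton B" "induced_path E (J (Inr b)) A B"
        "touch E (J (Inl s)) A" "touch E (J (Inl t)) B"
      and nt: "\<And>a. a \<in> pV F \<Longrightarrow> (a, b) \<notin> pS F \<Longrightarrow>
         \<not> touch E (J (Inl a)) (J (Inr b) - (if a = s then A else if a = t then B else {}))"
      by blast
    obtain x y where xy: "A = {x}" "B = {y}"
      using AB(1,2) by (auto elim!: is_singletonE)
    obtain m g where mg: "path_enum E (J (Inr b)) x y m g"
      using AB(3) unfolding xy induced_path_iff[of E, OF sym irrefl] by blast
    then have g: "g 1 = x" "g m = y"
      by (simp_all add: path_enum_def)
    have "a = s \<and> z = g 1 \<or> a = t \<and> z = g m"
      if "a \<in> pV F" "(a, b) \<notin> pS F" "z \<in> J (Inr b)" "E (pt a) z" for a z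
      using nt[OF that(1,2)] that(3,4) unfolding touch_def pt[OF that(1)] xy g by (auto split: if_splits)
    then have "good b s t m g"
      unfolding good_def using st AB(4,5) mg
      unfolding touch_def pt[OF st(1)] pt[OF st(2)] xy g[symmetric] by blast
    then show ?thesis
      by blast
  qed
  then obtain s t m g where good: "\<And>b. b \<in> pU F \<Longrightarrow> good b (s b) (t b) (m b) (g b)"
    by metis
  have
    st: "\<And>b. b \<in> pU F \<Longrightarrow> s b \<in> pV F" "\<And>b. b \<in> pU F \<Longrightarrow> t b \<in> pV F" "\<And>b. b \<in> pU F \<Longrightarrow> pEnds F b = {s b, t b}"
    and pe: "\<And>b. b \<in> pU F \<Longrightarrow> path_enum E (J (Inr b)) (g b 1) (g b (m b)) (m b) (g b)"
    and ends: "\<And>b. b \<in> pU F \<Longrightarrow> E (pt (s b)) (g b 1)" "\<And>b. b \<in> pU F \<Longrightarrow> E (pt (t b)) (g b (m b))"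
    and sp: "\<And>a b x. \<lbrakk>b \<in> pU F; a \<in> pV F; (a, b) \<notin> pS F; x \<in> J (Inr b); E (pt a) x\<rbrakk> \<Longrightarrow>
        a = s b \<and> x = g b 1 \<or> a = t b \<and> x = g b (m b)"
    using good unfolding good_def by blast+
  have m: "1 \<le> m b" and bij: "bij_betw (g b) {1..m b} (J (Inr b))"
    and gg: "\<And>i j. i \<in> {1..m b} \<Longrightarrow> j \<in> {1..m b} \<Longrightarrow> E (g b i) (g b j) \<longleftrightarrow> i = Suc j \<or> j = Suc i"
    if "b \<in> pU F" for b
    using pe[OF that] by (auto simp: path_enum_def)
  have ginj: "i = j" if "b \<in> pU F" "i \<in> {1..m b}" "j \<in> {1..m b}" "g b i = g b j" for b i j
    using bij[OF that(1)] that by (auto simp: bij_betw_def dest: inj_onD)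
  have Ju: "J (Inr b) = g b ` {1..m b}" if "b \<in> pU F" for b
    using bij[OF that] by (simp add: bij_betw_def)
  define f where "f x = (case x of Inl a \<Rightarrow> pt a | Inr (b, j) \<Rightarrow> g b j)" for x :: "'a + 'b \<times> nat"
  have f: "f (Inl a) = pt a" "f (Inr (b, j)) = g b j" for a b j
    by (simp_all add: f_def)
  let ?RV = "real_vertices F m"
  define ER where "ER = {{x, y} |x y. x \<in> ?RV \<and> y \<in> ?RV \<and> x \<noteq> y \<and> E (f x) (f y)}"
  have ER: "{x, y} \<in> ER \<longleftrightarrow> E (f x) (f y)" if "x \<in> ?RV" "y \<in> ?RV" "x \<noteq> y" for x y
    unfolding ER_def using that sym by (auto simp: doubleton_eq_iff)
  have int: "internal m b = (\<lambda>j. Inr (b, j)) ` {1..m b}" for b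
    by (auto simp: internal_def)
  have RV: "x \<in> ?RV \<longleftrightarrow> (case x of Inl a \<Rightarrow> a \<in> pV F | Inr (b, j) \<Rightarrow> b \<in> pU F \<and> j \<in> {1..m b})" for x
    by (auto simp: real_vertices_def internal_def split: sum.splits)
  \<comment> \<open>\<open>key x\<close> is the vertex or urpath of F to which \<open>x\<close>
    belongs. As roles are disjoint, \<open>f x\<close> determines \<open>key x\<close>, which
    reduces injectivity to a single role.\<close>
  define key where "key x = (case x of Inl a \<Rightarrow> Inl a | Inr (b, j) \<Rightarrow> Inr b)" for x :: "'a + 'b \<times> nat"
  have key: "f x \<in> J (key x)" "key x \<in> pV F <+> pU F" if "x \<in> ?RV" for x
    using that by (auto simp: RV key_def f_def pt Ju split: sum.splits)
  have inj: "inj_on f ?RV"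
  proof (rule inj_onI)
    fix x y assume xy: "x \<in> ?RV" "y \<in> ?RV" "f x = f y"
    then have "key x = key y"
      using key[of x] key[of y] disj by metis
    then show "x = y"
      using xy by (auto simp: RV key_def f_def split: sum.splits dest: ginj)
  qed
  have "is_realization F s t m ER"
    unfolding is_realization_def
  proof (intro conjI)
    show "\<forall>u\<in>pU F. pEnds F u = {s u, t u} \<and> 1 \<le> m u"
      using st m by blast
    show "(image Inl) ` pE F \<subseteq> ER"
    proof (rule image_subsetI)
      fix e assume e: "e \<in> pE F"
      then have "e \<in> doubletons (pV F)"
        using wf unfolding wf_pathograph_def by blast
      then obtain a a' where a: "e = {a, a'}" "a \<noteq> a'" "a \<in> pV F" "a' \<in> pV F"
        unfolding doubletons_def by blast
      then show "Inl ` e \<in> ER"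
        using ER[of "Inl a" "Inl a'"] vv[of a a'] e by (simp add: RV f)
    qed
    show "\<forall>u\<in>pU F. path_edges s t m u \<subseteq> ER"
    proof (intro ballI subsetI)
      fix b e assume b: "b \<in> pU F" and "e \<in> path_edges s t m b"
      then consider "e = {Inl (s b), Inr (b, 1)}" | "e = {Inl (t b), Inr (b, m b)}"
        | j where "e = {Inr (b, j), Inr (b, Suc j)}" "1 \<le> j" "j < m b"
        unfolding path_edges_def by (auto simp: insert_commute)
      then show "e \<in> ER"
      proof cases
        case 1
        then show ?thesis
          using ER[of "Inl (s b)" "Inr (b, 1)"] ends(1)[OF b] m[OF b] st(1)[OF b] b by (simp add: RV f)
      next
        case 2
        then show ?thesis
          using ER[of "Inl (t b)" "Inr (b, m b)"] ends(2)[OF b] m[OF b] st(2)[OF b] b by (simp add: RV f)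
      next
        case 3
        then show ?thesis
          using ER[of "Inr (b, j)" "Inr (b, Suc j)"] gg[OF b, of j "Suc j"] b by (simp add: RV f)
      qed
    qed
    show "ER \<subseteq> (image Inl) ` pE F \<union> (\<Union>u\<in>pU F. path_edges s t m u) \<union> spoke_edges F m \<union> rung_edges F m"
      (is "_ \<subseteq> ?D")
    proof
      \<comment> \<open>Stated for one order of the two ends; both mixed cases below reduce to
        it.\<close>
      have mixed: "{Inl a, Inr (b, j)} \<in> ?D"
        if "a \<in> pV F" "b \<in> pU F" "j \<in> {1..m b}" "E (pt a) (g b j)" for a b j
      proof (cases "(a, b) \<in> pS F")
        case True
        moreover have "Inr (b, j) \<in> internal m b"
          using that unfolding int by blast
        ultimately have "{Inl a, Inr (b, j)} \<in> spoke_edges F m"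
          unfolding spoke_edges_def by blast
        then show ?thesis
          by blast
      next
        case False
        then have "a = s b \<and> g b j = g b 1 \<or> a = t b \<and> g b j = g b (m b)"
          using sp that by (auto simp: Ju)
        then have "a = s b \<and> j = 1 \<or> a = t b \<and> j = m b"
          using ginj[OF that(2,3)] m[OF that(2)] by auto
        then have "{Inl a, Inr (b, j)} \<in> path_edges s t m b"
          by (auto simp: path_edges_def insert_commute)
        then show ?thesis
          using that by blast
      qed
      fix e assume "e \<in> ER"
      then obtain x y where xy: "e = {x, y}" "x \<in> ?RV" "y \<in> ?RV" "x \<noteq> y" "E (f x) (f y)"
        unfolding ER_def by blast
      consider a a' where "x = Inl a" "y = Inl a'" | a b j where "x = Inl a" "y = Inr (b, j)"
        | a b j where "x = Inr (b, j)" "y = Inl a" | b i b' j where "x = Inr (b, i)" "y = Inr (b', j)"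
        by (cases x; cases y) auto
      then show "e \<in> ?D"
      proof cases
        case 1
        then have "{a, a'} \<in> pE F"
          using xy vv[of a a'] by (auto simp: RV f)
        then have "(Inl ` {a, a'} :: ('a + 'b \<times> nat) set) \<in> (image Inl) ` pE F"
          by (rule imageI)
        then show ?thesis
          using 1 xy by simp
      next
        case 2
        then show ?thesis
          unfolding xy(1) 2 by (intro mixed) (use xy 2 in \<open>auto simp: RV f\<close>)
      next
        case 3
        then show ?thesis
          unfolding xy(1) 3 insert_commute[of "Inr (b, j)" "Inl a"]
          by (intro mixed) (use xy 3 sym in \<open>auto simp: RV f\<close>)
      next
        case 4
        then have b: "b \<in> pU F" "b' \<in> pU F" and ij: "i \<in> {1..m b}" "j \<in> {1..m b'}" and E: "E (g b i) (g b' j)"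
          using xy by (auto simp: RV f)
        show ?thesis
        proof (cases "b = b'")
          case True
          then have "i = Suc j \<or> j = Suc i"
            using gg[OF b(1), of i j] ij E by simp
          then have "e \<in> path_edges s t m b"
            using ij True unfolding xy(1) 4 by (auto simp: path_edges_def doubleton_eq_iff)
          then show ?thesis
            using b by blast
        next
          case False
          then have "touch E (J (Inr b)) (J (Inr b')) \<longleftrightarrow> {b, b'} \<in> pR F"
            using rung b by blast
          moreover have "touch E (J (Inr b)) (J (Inr b'))"
            unfolding touch_def Ju[OF b(1)] Ju[OF b(2)] using ij E by blast
          moreover have "x \<in> internal m b" "y \<in> internal m b'"
            unfolding 4 int using ij by blast+
          ultimately have "{x, y} \<in> rung_edges F m"
            unfolding rung_edges_def using False by blast
          then show ?thesis
            unfolding xy(1) by blast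
        qed
      qed
    qed
    show "\<forall>(v, u)\<in>pS F. \<exists>x\<in>internal m u. {Inl v, x} \<in> ER"
    proof (rule ballI, clarify)
      fix a b assume ab: "(a, b) \<in> pS F"
      then have V: "a \<in> pV F" "b \<in> pU F"
        using wf unfolding wf_pathograph_def by auto
      have "touch E (J (Inl a)) (J (Inr b))"
        using spoke ab by blast
      then obtain j where "j \<in> {1..m b}" "E (pt a) (g b j)"
        unfolding touch_def pt[OF V(1)] Ju[OF V(2)] by blast
      then show "\<exists>x\<in>internal m b. {Inl a, x} \<in> ER"
        using ER[of "Inl a" "Inr (b, j)"] V by (auto simp: RV f int)
    qed
    show "\<forall>u u'. {u, u'} \<in> pR F \<and> u \<noteq> u' \<longrightarrow> (\<exists>x\<in>internal m u. \<exists>y\<in>internal m u'. {x, y} \<in> ER)"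
    proof (intro allI impI)
      fix b b' assume bb: "{b, b'} \<in> pR F \<and> b \<noteq> b'"
      then have "{b, b'} \<in> doubletons (pU F)"
        using wf unfolding wf_pathograph_def by blast
      then have b: "b \<in> pU F" "b' \<in> pU F"
        by (auto simp: doubletons_def doubleton_eq_iff)
      have "touch E (J (Inr b)) (J (Inr b'))"
        using rung b bb by blast
      then obtain i j where ij: "i \<in> {1..m b}" "j \<in> {1..m b'}" "E (g b i) (g b' j)"
        unfolding touch_def Ju[OF b(1)] Ju[OF b(2)] by blast
      then have "{Inr (b, i), Inr (b', j)} \<in> ER"
        using ER[of "Inr (b, i)" "Inr (b', j)"] b bb by (simp add: RV f)
      then show "\<exists>x\<in>internal m b. \<exists>y\<in>internal m b'. {x, y} \<in> ER"
        unfolding int using ij by blast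
    qed
  qed
  moreover have "f ` ?RV \<subseteq> V"
    using key(1) JV by blast
  ultimately show ?thesis
    unfolding contains_pathograph_def doubleton_in_edges_iff[of E, OF sym] using inj ER
    by (intro exI[of _ s] exI[of _ t] exI[of _ m] exI[of _ ER] exI[of _ f] conjI ballI impI)
qed

section \<open>Embeddings as monadic second-order properties\<close>

lemma mso_ex_subset:
  assumes "mso \<Gamma> K (\<lambda>w I. Q w I (I k))" "k \<in> K" "k \<noteq> k0"
    and "\<And>w I A B. Q w (I(k := A)) B = Q w I B"
  shows "mso \<Gamma> K (\<lambda>w I. \<exists>A\<subseteq>I k0. Q w I A)"
proof -
  have "mso \<Gamma> K (\<lambda>w I. \<exists>A\<subseteq>{..<length w}. A \<subseteq> I k0 \<and> Q w I A)"
    by (rule mso_ex_set[where k = k]) (use assms in \<open>auto intro!: mso_conj mso_subset set_term_intros\<close>)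
  \<comment> \<open>The value of \<open>I k0\<close> consists of positions of the word, so the bound
    by the length is automatic.\<close>
  moreover have "(\<exists>A\<subseteq>{..<length w}. A \<subseteq> I k0 \<and> Q w I A) \<longleftrightarrow> (\<exists>A\<subseteq>I k0. Q w I A)"
    if "I k0 \<subseteq> {..<length w}" for w :: "'a list" and I
    using that by blast
  ultimately show ?thesis
    by (subst mso_cong[where Q' = "\<lambda>w I. \<exists>A\<subseteq>{..<length w}. A \<subseteq> I k0 \<and> Q w I A"]) blast+
qed

lemma mso_all_subset:
  assumes "mso \<Gamma> K (\<lambda>w I. Q w I (I k))" "k \<in> K" "k \<noteq> k0"
    and "\<And>w I A B. Q w (I(k := A)) B = Q w I B"
  shows "mso \<Gamma> K (\<lambda>w I. \<forall>A\<subseteq>I k0. Q w I A)"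
  using mso_not[OF mso_ex_subset[where Q = "\<lambda>w I A. \<not> Q w I A", OF mso_not[OF assms(1)] assms(2,3)]] assms(4)
  by simp

lemma mso_connects:
  assumes "finite \<Gamma>" "finite K" "symp far" "z \<in> K" "z \<notin> {x, a, b}"
  shows "mso \<Gamma> K (\<lambda>w I. connects (word_adj far near w) (I x) (I a) (I b))"
  unfolding connects_def
  by (intro mso_conj mso_all_subset[where k = z] mso_imp mso_not mso_touch mso_subset set_term_intros assms)
    (use assms(5) in auto)

lemma mso_induced_path:
  assumes "finite \<Gamma>" "finite K" "symp far" "y \<in> K" "z \<in> K" "y \<notin> {x, a, b}" "z \<notin> {x, y, a, b}"
  shows "mso \<Gamma> K (\<lambda>w I. induced_path (word_adj far near w) (I x) (I a) (I b))"
proof -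
  have *: "(\<forall>Y\<subset>X. P Y) \<longleftrightarrow> (\<forall>Y\<subseteq>X. Y \<subset> X \<longrightarrow> P Y)" for X :: "nat set" and P
    by blast
  show ?thesis
    unfolding induced_path_def *
    by (intro mso_conj mso_all_subset[where k = y] mso_imp mso_not mso_connects[where z = z] mso_psubset
        set_term_intros assms) (use assms(6,7) in auto)
qed

text \<open>The variables \<open>Inl k\<close> hold the roles. The four others store bound sets: 0
  and 1 the sets \<open>A\<close> and \<open>B\<close> of an urpath, 2 the proper subset in
  \<open>induced_path\<close>, and 3 the closed set in \<open>connects\<close>.\<close>

lemma mso_embedding:
  fixes F :: "('a, 'b) pathograph" and K :: "(('a + 'b) + nat) set"
  assumes wf: "wf_pathograph F" and fin: "finite \<Gamma>" "finite K" "symp far" and K: "Inr ` {0, 1, 2, 3} \<subseteq> K"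
  shows "mso \<Gamma> K (\<lambda>w I. embedding (word_adj far near w) F (\<lambda>k. I (Inl k)))"
proof -
  have fins: "finite (pV F)" "finite (pU F)"
    using wf unfolding wf_pathograph_def by auto
  then have "finite (pS F)"
    using wf unfolding wf_pathograph_def by (meson finite_SigmaI finite_subset)
  note fins = fins this
  have K': "Inr 0 \<in> K" "Inr 1 \<in> K" "Inr 2 \<in> K" "Inr 3 \<in> K"
    using K by auto
  have ip: "mso \<Gamma> K (\<lambda>w I. induced_path (word_adj far near w) (I (Inl x)) (I (Inr 0)) (I (Inr 1)))" for x
    by (rule mso_induced_path[where y = "Inr 2" and z = "Inr 3"]) (use fin K' in auto)
  have ends: "mso \<Gamma> K (\<lambda>w I. \<exists>A\<subseteq>I (Inl (Inr b)). \<exists>B\<subseteq>I (Inl (Inr b)). is_singleton A \<and> is_singleton B \<and>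
           induced_path (word_adj far near w) (I (Inl (Inr b))) A B \<and>
           touch (word_adj far near w) (I (Inl (Inl s))) A \<and> touch (word_adj far near w) (I (Inl (Inl t))) B \<and>
           (\<forall>a\<in>pV F. (a, b) \<notin> pS F \<longrightarrow> \<not> touch (word_adj far near w) (I (Inl (Inl a)))
              (I (Inl (Inr b)) - (if a = s then A else if a = t then B else {}))))" for b s t
    by (rule mso_ex_subset[where k = "Inr 0"], rule mso_ex_subset[where k = "Inr 1"],
        intro mso_conj mso_ball mso_imp mso_not mso_const mso_touch mso_singleton ip set_term_intros fin fins)
      (use K' in simp_all)
  show ?thesis
    unfolding embedding_def case_prod_beta
    by (intro mso_conj mso_ball mso_bex mso_imp mso_iff mso_const mso_touch mso_singleton
        mso_disjoint ends set_term_intros fin fins finite_Plus)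
qed

lemma regular_contains_pathograph:
  fixes F :: "('a, 'b) pathograph" and \<Gamma> :: "'c set"
  assumes wf: "wf_pathograph F" and fin: "finite \<Gamma>" and sym: "symp far"
  shows "regular \<Gamma> (\<lambda>w. contains_pathograph {..<length w} {{p, q} |p q. word_adj far near w p q} F)"
proof -
  let ?N = "pV F <+> pU F"
  define K :: "(('a + 'b) + nat) set" where "K = Inl ` ?N \<union> Inr ` {0, 1, 2, 3}"
  define K0 :: "(('a + 'b) + nat) set" where "K0 = Inl ` ?N"
  have finK: "finite K"
    using wf unfolding K_def wf_pathograph_def by auto
  have "mso \<Gamma> K (\<lambda>w I. \<exists>J :: ('a + 'b) + nat \<Rightarrow> nat set. (\<forall>k. J k \<subseteq> {..<length w}) \<and>
      embedding (word_adj far near w) F (\<lambda>k. if Inl k \<in> K0 then J (Inl k) else I (Inl k)))"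
    by (rule mso_ex_family[OF mso_embedding, where ?K0.0 = K0]) (use wf fin finK sym in \<open>auto simp: K_def K0_def\<close>)
  \<comment> \<open>Every letter of the plain word is annotated with the empty set, so all tracks
    are empty and the variables outside \<open>K0\<close> contribute nothing.\<close>
  then have reg: "regular \<Gamma> (\<lambda>w. \<exists>J :: ('a + 'b) + nat \<Rightarrow> nat set. (\<forall>k. J k \<subseteq> {..<length (map fst (map (\<lambda>c. (c, {} :: (('a + 'b) + nat) set)) w))}) \<and>
      embedding (word_adj far near (map fst (map (\<lambda>c. (c, {} :: (('a + 'b) + nat) set)) w))) F
        (\<lambda>k. if Inl k \<in> K0 then J (Inl k) else track (map (\<lambda>c. (c, {} :: (('a + 'b) + nat) set)) w) (Inl k)))"
    unfolding mso_def by (rule regular_map) auto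
  have K0: "Inl k \<in> K0 \<longleftrightarrow> k \<in> ?N" for k
    by (auto simp: K0_def)
  have track: "track (map (\<lambda>c. (c, {} :: (('a + 'b) + nat) set)) w) k = {}" for w :: "'c list" and k
    by (auto simp: track_def)
  have "regular \<Gamma> (\<lambda>w. \<exists>J :: ('a + 'b) + nat \<Rightarrow> nat set. (\<forall>k. J k \<subseteq> {..<length w}) \<and>
      embedding (word_adj far near w) F (\<lambda>k. if k \<in> ?N then J (Inl k) else {}))"
    using reg unfolding K0 track by (simp add: comp_def)
  moreover have "contains_pathograph {..<length w} {{p, q} |p q. word_adj far near w p q} F \<longleftrightarrow>
      (\<exists>J :: ('a + 'b) + nat \<Rightarrow> nat set. (\<forall>k. J k \<subseteq> {..<length w}) \<and>
        embedding (word_adj far near w) F (\<lambda>k. if k \<in> ?N then J (Inl k) else {}))" (is "?L \<longleftrightarrow> ?R")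
    for w :: "'c list"
  proof
    have E: "word_adj far near w p q = word_adj far near w q p" "\<not> word_adj far near w p p" for p q
      using word_adj_sym[OF sym] by (auto simp: word_adj_def)
    {
      assume ?L
      from contains_imp_embedding[OF wf E this] obtain J where J: "\<And>k. J k \<subseteq> {..<length w}" "\<And>k. k \<notin> ?N \<Longrightarrow> J k = {}"
        "embedding (word_adj far near w) F J"
        by (elim exE conjE) (rule that; simp)
      \<comment> \<open>The family quantifier also ranges over the storage variables; they are
        filled with empty sets.\<close>
      define J' :: "('a + 'b) + nat \<Rightarrow> nat set" where "J' = case_sum J (\<lambda>_. {})"
      have "(\<lambda>k. if k \<in> ?N then J' (Inl k) else {}) = J"
        by (simp add: fun_eq_iff J'_def J(2))
      with J(3) have "embedding (word_adj far near w) F (\<lambda>k. if k \<in> ?N then J' (Inl k) else {})"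
        by (simp only:)
      moreover have "\<forall>k. J' k \<subseteq> {..<length w}"
        using J(1) by (simp add: J'_def split: sum.split)
      ultimately show ?R
        by (intro exI[of _ J'] conjI)
    }
    {
      assume ?R
      then obtain J :: "('a + 'b) + nat \<Rightarrow> nat set" where "\<And>k. J k \<subseteq> {..<length w}"
        "embedding (word_adj far near w) F (\<lambda>k. if k \<in> ?N then J (Inl k) else {})"
        by blast
      then show ?L
        by (intro embedding_imp_contains[OF wf E]) auto
    }
  qed
  ultimately show ?thesis
    by simp
qed

section \<open>Realizations as words\<close>

lemma contains_pathograph_mono:
  assumes "inj_on g V" "g ` V \<subseteq> V'"
    and E: "\<And>p q. \<lbrakk>p \<in> V; q \<in> V; p \<noteq> q\<rbrakk> \<Longrightarrow> {p, q} \<in> EG \<longleftrightarrow> {g p, g q} \<in> EG'"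
    and "contains_pathograph V EG F"
  shows "contains_pathograph V' EG' F"
proof -
  obtain lft rgt m ER f where f: "is_realization F lft rgt m ER" "inj_on f (real_vertices F m)"
    "f ` real_vertices F m \<subseteq> V"
    "\<And>x y. \<lbrakk>x \<in> real_vertices F m; y \<in> real_vertices F m; x \<noteq> y\<rbrakk> \<Longrightarrow> {x, y} \<in> ER \<longleftrightarrow> {f x, f y} \<in> EG"
    using assms(4) unfolding contains_pathograph_def by metis
  have "{x, y} \<in> ER \<longleftrightarrow> {(g \<circ> f) x, (g \<circ> f) y} \<in> EG'"
    if "x \<in> real_vertices F m" "y \<in> real_vertices F m" "x \<noteq> y" for x y
  proof -
    have "f x \<in> V" "f y \<in> V" "f x \<noteq> f y"
      using f(2,3) that by (auto dest: inj_onD)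
    then show ?thesis
      using f(4)[OF that] E[of "f x" "f y"] by simp
  qed
  moreover have "inj_on (g \<circ> f) (real_vertices F m)"
    using f(2,3) assms(1) by (meson comp_inj_on inj_on_subset)
  moreover have "(g \<circ> f) ` real_vertices F m \<subseteq> V'"
    using f(3) assms(2) by auto
  ultimately show ?thesis
    unfolding contains_pathograph_def using f(1)
    by (intro exI[of _ lft] exI[of _ rgt] exI[of _ m] exI[of _ ER] exI[of _ "g \<circ> f"] conjI ballI impI)
qed

lemma contains_pathograph_transfer:
  assumes bij: "bij_betw g V V'"
    and E: "\<And>p q. \<lbrakk>p \<in> V; q \<in> V; p \<noteq> q\<rbrakk> \<Longrightarrow> {p, q} \<in> EG \<longleftrightarrow> {g p, g q} \<in> EG'"
  shows "contains_pathograph V EG F \<longleftrightarrow> contains_pathograph V' EG' F"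
proof
  show "contains_pathograph V' EG' F" if "contains_pathograph V EG F"
    by (rule contains_pathograph_mono[OF _ _ E that]) (use bij in \<open>auto simp: bij_betw_def\<close>)
  let ?h = "inv_into V g"
  have h: "?h x \<in> V" "g (?h x) = x" if "x \<in> V'" for x
    using that bij by (auto simp: bij_betw_def inv_into_into f_inv_into_f)
  show "contains_pathograph V EG F" if "contains_pathograph V' EG' F"
  proof (rule contains_pathograph_mono[OF _ _ _ that])
    show "inj_on ?h V'"
      using h(2) by (metis inj_on_inverseI)
    show "?h ` V' \<subseteq> V"
      using h(1) by auto
    show "{x, y} \<in> EG' \<longleftrightarrow> {?h x, ?h y} \<in> EG" if "x \<in> V'" "y \<in> V'" "x \<noteq> y" for x y
      using E[of "?h x" "?h y"] h that by metis
  qed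
qed

text \<open>\<open>Inl v\<close> is the letter of a vertex of H, and \<open>Inr (i, S)\<close> that
  of an interior vertex of the i-th urpath with neighbours \<open>S\<close> among the vertices of H.
  Two interior letters are never related, because without rungs they are joined only along an
  urpath.\<close>

fun letter_far :: "('v, 'u) pathograph \<Rightarrow> 'v + nat \<times> 'v set \<Rightarrow> 'v + nat \<times> 'v set \<Rightarrow> bool" where
  "letter_far H (Inl v) (Inl v') \<longleftrightarrow> {v, v'} \<in> pE H"
| "letter_far H (Inl v) (Inr (i, S)) \<longleftrightarrow> v \<in> S"
| "letter_far H (Inr (i, S)) (Inl v) \<longleftrightarrow> v \<in> S"
| "letter_far H (Inr (i, S)) (Inr (i', S')) \<longleftrightarrow> False"

text \<open>The index keeps the end of one urpath from being joined to the start of the next, and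
  the vertices of the prefix gain no edges from being written side by side.\<close>

fun letter_near :: "'v + nat \<times> 'v set \<Rightarrow> 'v + nat \<times> 'v set \<Rightarrow> bool" where
  "letter_near (Inr (i, S)) (Inr (i', S')) \<longleftrightarrow> i = i'"
| "letter_near _ _ \<longleftrightarrow> False"

lemma symp_letter_far: "symp (letter_far H)"
proof (rule sympI)
  fix c d assume "letter_far H c d"
  then show "letter_far H d c"
    by (induction H c d rule: letter_far.induct) (auto simp: insert_commute)
qed

section \<open>Reading order of the interior vertices\<close>

definition positions :: "(nat \<Rightarrow> nat) \<Rightarrow> nat \<Rightarrow> (nat \<times> nat) list" where
  "positions M n = concat (map (\<lambda>i. map (Pair i) [1..<Suc (M i)]) [0..<n])"

lemma set_positions: "set (positions M n) = {(i, j). i < n \<and> 1 \<le> j \<and> j \<le> M i}"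
  by (auto simp: positions_def image_iff simp del: upt_Suc)

definition lex_less :: "nat \<times> nat \<Rightarrow> nat \<times> nat \<Rightarrow> bool" where
  "lex_less a b \<longleftrightarrow> fst a < fst b \<or> fst a = fst b \<and> snd a < snd b"

lemma sorted_positions: "sorted_wrt lex_less (positions M n)"
proof (induction n)
  case 0
  then show ?case
    by (simp add: positions_def)
next
  case (Suc n)
  have "positions M (Suc n) = positions M n @ map (Pair n) [1..<Suc (M n)]"
    by (simp add: positions_def)
  moreover have "sorted_wrt lex_less (map (Pair n) [1..<Suc (M n)])"
    unfolding sorted_wrt_map by (rule sorted_wrt_mono_rel[OF _ sorted_wrt_upt]) (simp add: lex_less_def)
  moreover have "lex_less a b" if "a \<in> set (positions M n)" "b \<in> set (map (Pair n) [1..<Suc (M n)])" for a b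
    using that by (auto simp: set_positions lex_less_def)
  ultimately show ?case
    using Suc by (simp only: sorted_wrt_append) blast
qed

lemma positions_nth_less:
  assumes "p < length (positions M n)" "q < length (positions M n)"
  shows "p < q \<longleftrightarrow> lex_less (positions M n ! p) (positions M n ! q)"
proof -
  have "p < q \<Longrightarrow> lex_less (positions M n ! p) (positions M n ! q)"
    "q < p \<Longrightarrow> lex_less (positions M n ! q) (positions M n ! p)"
    using sorted_positions[of M n] assms by (auto simp: sorted_wrt_iff_nth_less)
  then show ?thesis
    by (auto simp: lex_less_def nat_neq_iff) (metis less_asym nat_neq_iff)+
qed

lemma distinct_positions: "distinct (positions M n)"
  unfolding distinct_conv_nth
proof (intro allI impI)
  fix p q
  assume pq: "p < length (positions M n)" "q < length (positions M n)" "p \<noteq> q"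
  then have "lex_less (positions M n ! p) (positions M n ! q) \<or> lex_less (positions M n ! q) (positions M n ! p)"
    using positions_nth_less[OF pq(1,2)] positions_nth_less[OF pq(2,1)] by linarith
  then show "positions M n ! p \<noteq> positions M n ! q"
    unfolding lex_less_def by (metis less_irrefl)
qed

text \<open>Nothing lies lexicographically between \<open>(i, j)\<close> and
  \<open>(i, Suc j)\<close>, and the list has no gaps: with two pairs of equal first component it
  contains all pairs between them.\<close>

lemma positions_consecutive:
  assumes p: "p < length (positions M n)" "positions M n ! p = (i, j)"
    and q: "q < length (positions M n)" "positions M n ! q = (i, j')"
  shows "q = Suc p \<longleftrightarrow> j' = Suc j"
proof
  let ?L = "positions M n"
  assume "q = Suc p"
  then have "j < j'"
    using positions_nth_less[OF p(1) q(1)] p q by (simp add: lex_less_def)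
  show "j' = Suc j"
  proof (rule ccontr)
    assume "j' \<noteq> Suc j"
    then have "(i, Suc j) \<in> set ?L"
      using \<open>j < j'\<close> nth_mem[OF p(1)] nth_mem[OF q(1)] p(2) q(2) by (auto simp: set_positions)
    then obtain r where r: "r < length ?L" "?L ! r = (i, Suc j)"
      by (auto simp: in_set_conv_nth)
    have "p < r" "r < q"
      using positions_nth_less[OF p(1) r(1)] positions_nth_less[OF r(1) q(1)] p q r \<open>j < j'\<close> \<open>j' \<noteq> Suc j\<close>
      by (auto simp: lex_less_def)
    with \<open>q = Suc p\<close> show False
      by simp
  qed
next
  let ?L = "positions M n"
  assume j': "j' = Suc j"
  then have "p < q"
    using positions_nth_less[OF p(1) q(1)] p q by (simp add: lex_less_def)
  show "q = Suc p"
  proof (rule ccontr)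
    assume "q \<noteq> Suc p"
    with \<open>p < q\<close> have r: "Suc p < q" "Suc p < length ?L"
      using q by auto
    obtain k l where "?L ! Suc p = (k, l)"
      by force
    then show False
      using positions_nth_less[OF p(1) r(2)] positions_nth_less[OF r(2) q(1)] r p q j'
      by (auto simp: lex_less_def)
  qed
qed

text \<open>Sending a position to the vertex it stands for is a graph isomorphism, and containment
  is invariant under isomorphism.\<close>

lemma contains_pathograph_realization_iff:
  fixes H :: "('v, 'u) pathograph"
  assumes real: "is_realization H lft rgt m EG" and no_rungs: "pR H = {}"
    and us: "distinct us" "set us = pU H" and vl: "distinct vl" "set vl = pV H"
    and w: "w = map Inl vl @ map Inr (determination_string H us m EG)"
  shows "contains_pathograph (real_vertices H m) EG F \<longleftrightarrow>
    contains_pathograph {..<length w} {{p, q} |p q. word_adj (letter_far H) letter_near w p q} F"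
proof -
  define ps where "ps = positions (\<lambda>i. m (us ! i)) (length us)"
  \<comment> \<open>\<open>ws\<close> names each position by a vertex or by an urpath number with a
    place on that urpath; \<open>lab\<close> turns names into letters and \<open>vert\<close> into
    vertices of the realization. Urpath numbers start from 0 here, hence \<open>Suc i\<close> in the
    letter.\<close>
  define ws :: "('v + nat \<times> nat) list" where "ws = map Inl vl @ map Inr ps"
  define lab :: "'v + nat \<times> nat \<Rightarrow> 'v + nat \<times> 'v set" where
    "lab x = (case x of Inl v \<Rightarrow> Inl v | Inr (i, j) \<Rightarrow> Inr (Suc i, {v \<in> pV H. {Inl v, Inr (us ! i, j)} \<in> EG}))" for x
  define vert :: "'v + nat \<times> nat \<Rightarrow> 'v + 'u \<times> nat" where
    "vert x = (case x of Inl v \<Rightarrow> Inl v | Inr (i, j) \<Rightarrow> Inr (us ! i, j))" for x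
  have w_lab: "w = map lab ws"
    unfolding w ws_def ps_def positions_def determination_string_def
    by (simp add: lab_def map_concat comp_def)
  have len: "length w = length ws"
    unfolding w_lab by simp
  have ps: "distinct ps" "set ps = {(i, j). i < length us \<and> 1 \<le> j \<and> j \<le> m (us ! i)}"
    unfolding ps_def by (simp_all add: distinct_positions set_positions)
  have distinct: "distinct ws"
    unfolding ws_def using vl(1) ps(1) by (auto simp: distinct_map)
  have set_ws: "set ws = Inl ` pV H \<union> Inr ` set ps"
    unfolding ws_def using vl(2) by simp
  have us_nth: "us ! i \<in> pU H" if "i < length us" for i
    unfolding us(2)[symmetric] using that by (rule nth_mem)
  have us_inj: "i = i'" if "i < length us" "i' < length us" "us ! i = us ! i'" for i i'
    using that us(1) by (simp add: nth_eq_iff_index_eq)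
  have inj: "inj_on vert (set ws)"
    unfolding set_ws ps(2) by (rule inj_onI) (auto simp: vert_def dest: us_inj)
  have "vert ` set ws = real_vertices H m"
  proof
    show "vert ` set ws \<subseteq> real_vertices H m"
      unfolding set_ws ps(2) by (auto simp: vert_def real_vertices_def internal_def us_nth)
    show "real_vertices H m \<subseteq> vert ` set ws"
    proof
      fix x assume "x \<in> real_vertices H m"
      then consider v where "x = Inl v" "v \<in> pV H" | u j where "x = Inr (u, j)" "u \<in> pU H" "1 \<le> j" "j \<le> m u"
        by (auto simp: real_vertices_def internal_def)
      then show "x \<in> vert ` set ws"
      proof cases
        case 1
        then show ?thesis
          unfolding set_ws by (intro image_eqI[of _ _ "Inl v"]) (auto simp: vert_def)
      next
        case 2
        then obtain i where "i < length us" "u = us ! i"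
          using us(2) by (metis in_set_conv_nth)
        with 2 show ?thesis
          unfolding set_ws ps(2) by (intro image_eqI[of _ _ "Inr (i, j)"]) (auto simp: vert_def)
      qed
    qed
  qed
  moreover have "bij_betw ((!) ws) {..<length w} (set ws)"
    using distinct len by (simp add: bij_betw_nth)
  ultimately have bij: "bij_betw (\<lambda>p. vert (ws ! p)) {..<length w} (real_vertices H m)"
    using inj bij_betw_trans[of "(!) ws" _ _ vert] by (simp add: bij_betw_def comp_def)
  have sym: "word_adj (letter_far H) letter_near w p q = word_adj (letter_far H) letter_near w q p" for p q
    by (rule word_adj_sym[OF symp_letter_far])
  have ws_Inr: "length vl \<le> p \<and> p - length vl < length ps \<and> ps ! (p - length vl) = ij"
    if "p < length ws" "ws ! p = Inr ij" for p ij
    using that by (auto simp: ws_def nth_append split: if_splits)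
  have ws_mem: "ws ! p \<in> set ws" if "p < length ws" for p
    using that by simp
  \<comment> \<open>The case of an interior vertex at \<open>p\<close> and a vertex of H at
    \<open>q\<close> is left out; symmetry supplies it afterwards.\<close>
  have adj_case: "word_adj (letter_far H) letter_near w p q \<longleftrightarrow> {vert (ws ! p), vert (ws ! q)} \<in> EG"
    if pq: "p < length ws" "q < length ws" "p \<noteq> q" and c: "(\<exists>v. ws ! p = Inl v) \<or> (\<exists>i j i' j'. ws ! p = Inr (i, j) \<and> ws ! q = Inr (i', j'))"
    for p q
  proof -
    have nth: "w ! p = lab (ws ! p)" "w ! q = lab (ws ! q)"
      using pq by (simp_all add: w_lab)
    consider (vv) v v' where "ws ! p = Inl v" "ws ! q = Inl v'" | (vu) v i j where "ws ! p = Inl v" "ws ! q = Inr (i, j)"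
      | (uu) i j i' j' where "ws ! p = Inr (i, j)" "ws ! q = Inr (i', j')"
      using c by (cases "ws ! q") auto
    then show ?thesis
    proof cases
      case vv
      then show ?thesis
        using pq by (simp add: word_adj_def nth lab_def vert_def realization_edge_vertices[OF real])
    next
      case vu
      then have "v \<in> pV H"
        using ws_mem[OF pq(1)] by (auto simp: set_ws)
      with vu show ?thesis
        using pq by (simp add: word_adj_def nth lab_def vert_def)
    next
      case uu
      let ?n = "length vl"
      have ij: "(i, j) \<in> set ps" "(i', j') \<in> set ps"
        using ws_mem[OF pq(1)] ws_mem[OF pq(2)] uu by (auto simp: set_ws)
      have p: "?n \<le> p" "p - ?n < length ps" "ps ! (p - ?n) = (i, j)"
        and q: "?n \<le> q" "q - ?n < length ps" "ps ! (q - ?n) = (i', j')"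
        using ws_Inr pq uu by auto
      have adj: "word_adj (letter_far H) letter_near w p q \<longleftrightarrow> i = i' \<and> (q = Suc p \<or> p = Suc q)"
        by (auto simp: word_adj_def nth lab_def uu)
      show ?thesis
      proof (cases "i = i'")
        case True
        \<comment> \<open>Both positions lie behind the prefix, so subtracting its length does not
          affect being consecutive.\<close>
        have "q = Suc p \<longleftrightarrow> j' = Suc j" "p = Suc q \<longleftrightarrow> j = Suc j'"
          using positions_consecutive[OF p(2,3)[unfolded ps_def] q(2,3)[unfolded ps_def, folded True]]
            positions_consecutive[OF q(2,3)[unfolded ps_def, folded True] p(2,3)[unfolded ps_def]] p(1) q(1)
          by auto
        then show ?thesis
          unfolding adj using realization_edge_path[OF real us_nth, of i j j'] True ij
          by (auto simp: uu vert_def ps(2))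
      next
        case False
        then have "us ! i \<noteq> us ! i'"
          using ij us_inj by (auto simp: ps(2))
        then have "{vert (ws ! p), vert (ws ! q)} \<notin> EG"
          using realization_edge_rung[OF real, of "us ! i" j "us ! i'" j'] no_rungs by (auto simp: uu vert_def)
        then show ?thesis
          unfolding adj using False by simp
      qed
    qed
  qed
  have adj: "word_adj (letter_far H) letter_near w p q \<longleftrightarrow> {vert (ws ! p), vert (ws ! q)} \<in> EG"
    if pq: "p < length ws" "q < length ws" "p \<noteq> q" for p q
  proof (cases "(\<exists>v. ws ! p = Inl v) \<or> (\<exists>i j i' j'. ws ! p = Inr (i, j) \<and> ws ! q = Inr (i', j'))")
    case True
    then show ?thesis
      using adj_case pq by blast
  next
    case False
    then have "\<exists>v. ws ! q = Inl v"
      by (cases "ws ! p"; cases "ws ! q") auto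
    then show ?thesis
      using adj_case[of q p] pq sym[of p q] by (simp add: insert_commute)
  qed
  show ?thesis
  proof (rule contains_pathograph_transfer[OF bij, symmetric])
    fix p q assume "p \<in> {..<length w}" "q \<in> {..<length w}" "p \<noteq> q"
    then show "{p, q} \<in> {{p, q} |p q. word_adj (letter_far H) letter_near w p q} \<longleftrightarrow>
        {vert (ws ! p), vert (ws ! q)} \<in> EG"
      unfolding doubleton_in_edges_iff[of "word_adj (letter_far H) letter_near w", OF sym]
      by (intro adj) (simp_all add: len)
  qed
qed

section \<open>Determination strings\<close>

lemma regular_concat:
  assumes "\<And>i. i < n \<Longrightarrow> regular \<Sigma> (L i)"
  shows "regular \<Sigma> (\<lambda>w. \<exists>g. w = concat (map g [0..<n]) \<and> (\<forall>i<n. L i (g i)))"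
  using assms
proof (induction n)
  case 0
  then show ?case
    using regular_Nil by simp
next
  case (Suc n)
  have "(\<exists>g. w = concat (map g [0..<Suc n]) \<and> (\<forall>i<Suc n. L i (g i))) \<longleftrightarrow>
      (\<exists>x y. w = x @ y \<and> (\<exists>g. x = concat (map g [0..<n]) \<and> (\<forall>i<n. L i (g i))) \<and> L n y)" (is "?L \<longleftrightarrow> ?R") for w
  proof
    assume ?L
    then obtain g where "w = concat (map g [0..<Suc n])" "\<forall>i<Suc n. L i (g i)"
      by blast
    then show ?R
      by (intro exI[of _ "concat (map g [0..<n])"] exI[of _ "g n"] conjI exI[of _ g]) auto
  next
    assume ?R
    then obtain g y where g: "w = concat (map g [0..<n]) @ y" "\<forall>i<n. L i (g i)" "L n y"
      by auto
    have "map (g(n := y)) [0..<n] = map g [0..<n]"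
      by (rule map_cong) auto
    then show ?L
      using g by (intro exI[of _ "g(n := y)"]) auto
  qed
  moreover have "regular \<Sigma> (\<lambda>w. \<exists>x y. w = x @ y \<and>
      (\<exists>g. x = concat (map g [0..<n]) \<and> (\<forall>i<n. L i (g i))) \<and> L n y)"
    by (rule regular_append) (use Suc in auto)
  ultimately show ?case
    by (simp only:)
qed

text \<open>The strings that an urpath with endpoints a, b and set N of spoke vertices can contribute.\<close>

definition urpath_string :: "'v \<Rightarrow> 'v \<Rightarrow> 'v set \<Rightarrow> 'v set list \<Rightarrow> bool" where
  "urpath_string a b N \<tau> \<longleftrightarrow> \<tau> \<noteq> [] \<and> a \<in> \<tau> ! 0 \<and> b \<in> \<tau> ! (length \<tau> - 1) \<and>
     (\<forall>j<length \<tau>. \<forall>v\<in>\<tau> ! j. v \<in> N \<or> v = a \<and> j = 0 \<or> v = b \<and> Suc j = length \<tau>) \<and>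
     (\<forall>v\<in>N. \<exists>S\<in>set \<tau>. v \<in> S)"

text \<open>Unless \<open>a\<close> is a spoke vertex, the first clause confines it to the first
  letter; the second clause does the same for \<open>b\<close> and the last letter. Each
  distinguished letter may contain both ends, because a string of length 1 has only one letter. As
  \<open>a\<close> and \<open>b\<close> differ, the bounds \<open>insert a N\<close> and
  \<open>insert b N\<close> intersect in \<open>N\<close>, which settles the inner letters.\<close>

lemma urpath_string_iff:
  assumes "a \<noteq> b"
  shows "urpath_string a b N \<tau> \<longleftrightarrow>
     (\<exists>x y. \<tau> = x @ y \<and> (\<exists>S\<in>{S. a \<in> S \<and> S \<subseteq> insert a (insert b N)}. x = [S]) \<and> y \<in> lists {S. S \<subseteq> insert b N}) \<and>
     (\<exists>x y. \<tau> = x @ y \<and> x \<in> lists {S. S \<subseteq> insert a N} \<and> (\<exists>S\<in>{S. b \<in> S \<and> S \<subseteq> insert a (insert b N)}. y = [S])) \<and>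
     (\<forall>v\<in>N. \<exists>S\<in>set \<tau>. v \<in> S)" (is "_ \<longleftrightarrow> ?A \<and> ?B \<and> ?C")
proof
  assume u: "urpath_string a b N \<tau>"
  then have ne: "\<tau> \<noteq> []" and ends: "a \<in> \<tau> ! 0" "b \<in> \<tau> ! (length \<tau> - 1)" and ?C
    and sub: "\<And>j v. j < length \<tau> \<Longrightarrow> v \<in> \<tau> ! j \<Longrightarrow> v \<in> N \<or> v = a \<and> j = 0 \<or> v = b \<and> Suc j = length \<tau>"
    unfolding urpath_string_def by blast+
  have ?A
  proof (intro exI conjI)
    show "\<tau> = [hd \<tau>] @ tl \<tau>"
      using ne by simp
    show "\<exists>S\<in>{S. a \<in> S \<and> S \<subseteq> insert a (insert b N)}. [hd \<tau>] = [S]"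
      using ends(1) sub[of 0] ne by (auto simp: hd_conv_nth)
    have "tl \<tau> ! j \<subseteq> insert b N" if "j < length (tl \<tau>)" for j
    proof -
      have "Suc j < length \<tau>"
        using that by simp
      then show ?thesis
        using sub[of "Suc j"] that by (auto simp: nth_tl)
    qed
    then show "tl \<tau> \<in> lists {S. S \<subseteq> insert b N}"
      unfolding in_lists_conv_set Ball_def in_set_conv_nth by blast
  qed
  moreover have ?B
  proof (intro exI conjI)
    show "\<tau> = butlast \<tau> @ [last \<tau>]"
      using ne by simp
    show "\<exists>S\<in>{S. b \<in> S \<and> S \<subseteq> insert a (insert b N)}. [last \<tau>] = [S]"
      using ends(2) sub[of "length \<tau> - 1"] ne by (auto simp: last_conv_nth)
    have "butlast \<tau> ! j \<subseteq> insert a N" if "j < length (butlast \<tau>)" for j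
    proof -
      have "j < length \<tau>" "Suc j \<noteq> length \<tau>"
        using that by auto
      then show ?thesis
        using sub[of j] that by (auto simp: nth_butlast)
    qed
    then show "butlast \<tau> \<in> lists {S. S \<subseteq> insert a N}"
      unfolding in_lists_conv_set Ball_def in_set_conv_nth by blast
  qed
  ultimately show "?A \<and> ?B \<and> ?C"
    using \<open>?C\<close> by blast
next
  assume *: "?A \<and> ?B \<and> ?C"
  obtain S y where A: "\<tau> = S # y" "a \<in> S" "S \<subseteq> insert a (insert b N)" "\<And>T. T \<in> set y \<Longrightarrow> T \<subseteq> insert b N"
    using * by auto
  obtain S' x where B: "\<tau> = x @ [S']" "b \<in> S'" "\<And>T. T \<in> set x \<Longrightarrow> T \<subseteq> insert a N"
    using * by auto
  have "v \<in> N \<or> v = a \<and> j = 0 \<or> v = b \<and> Suc j = length \<tau>" if j: "j < length \<tau>" "v \<in> \<tau> ! j" for j v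
  proof -
    have "v \<in> insert b N" if "j \<noteq> 0"
      using A(4)[of "y ! (j - 1)"] j that by (auto simp: A(1) nth_Cons')
    moreover have "v \<in> insert a N" if "Suc j \<noteq> length \<tau>"
    proof -
      have "j < length x"
        using that j B(1) by auto
      then show ?thesis
        using B(3)[of "x ! j"] j by (auto simp: B(1) nth_append)
    qed
    moreover have "v \<in> insert a (insert b N)" if "j = 0"
      using A(1,3) j that by auto
    ultimately show ?thesis
      using assms by blast
  qed
  moreover have "\<tau> ! 0 = S" "\<tau> ! (length \<tau> - 1) = S'" "\<tau> \<noteq> []"
    using A(1) by (simp, metis B(1) length_append_singleton diff_Suc_1 nth_append_length, simp)
  ultimately show "urpath_string a b N \<tau>"
    unfolding urpath_string_def using A(2) B(2) * by blast
qed

lemma regular_urpath_string: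
  assumes "finite N" "a \<noteq> b"
  shows "regular \<Sigma> (urpath_string a b N)"
  unfolding urpath_string_iff[OF assms(2)]
  by (intro regular_conj regular_append regular_letter regular_lists regular_ball assms regular_ex_letter)

text \<open>That the second components are sets of vertices of H is not demanded here; the alphabet
  of the whole string ensures it.\<close>

definition block :: "('v, 'u) pathograph \<Rightarrow> ('u \<Rightarrow> 'v) \<Rightarrow> ('u \<Rightarrow> 'v) \<Rightarrow> 'u list \<Rightarrow> nat \<Rightarrow> (nat \<times> 'v set) list \<Rightarrow> bool" where
  "block H lft rgt us i w \<longleftrightarrow> w \<in> lists ({Suc i} \<times> UNIV) \<and>
     urpath_string (lft (us ! i)) (rgt (us ! i)) {v. (v, us ! i) \<in> pS H} (map snd w)"

lemma regular_block:
  assumes "wf_pathograph H" "lft (us ! i) \<noteq> rgt (us ! i)"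
  shows "regular (A \<times> B) (block H lft rgt us i)"
proof -
  have "{v. (v, us ! i) \<in> pS H} \<subseteq> pV H" "finite (pV H)"
    using assms unfolding wf_pathograph_def by auto
  then have "regular B (urpath_string (lft (us ! i)) (rgt (us ! i)) {v. (v, us ! i) \<in> pS H})"
    by (intro regular_urpath_string assms(2)) (rule finite_subset)
  then have "regular (A \<times> B) (\<lambda>w. urpath_string (lft (us ! i)) (rgt (us ! i)) {v. (v, us ! i) \<in> pS H} (map snd w))"
    by (rule regular_map) auto
  then show ?thesis
    unfolding block_def by (intro regular_conj regular_lists)
qed

section \<open>Realizations against sequences of blocks\<close>

lemma realization_imp_blocks:
  assumes wf: "wf_pathograph H" and us: "set us = pU H" and real: "is_realization H lft rgt m EG"
  shows "\<exists>g. determination_string H us m EG = concat (map g [0..<length us]) \<and>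
    (\<forall>i<length us. block H lft rgt us i (g i))"
proof -
  define g where "g i = map (\<lambda>j. (Suc i, {v \<in> pV H. {Inl v, Inr (us ! i, j)} \<in> EG})) [1..<Suc (m (us ! i))]" for i
  have "block H lft rgt us i (g i)" if i: "i < length us" for i
  proof -
    let ?u = "us ! i"
    have u: "?u \<in> pU H"
      unfolding us[symmetric] using i by (rule nth_mem)
    have m: "1 \<le> m ?u" and ends: "pEnds H ?u = {lft ?u, rgt ?u}" and pe: "path_edges lft rgt m ?u \<subseteq> EG"
      using real u unfolding is_realization_def by auto
    have "{lft ?u, rgt ?u} \<in> doubletons (pV H)"
      using wf u ends unfolding wf_pathograph_def by metis
    then have endsV: "lft ?u \<in> pV H" "rgt ?u \<in> pV H"
      by (auto simp: doubletons_def doubleton_eq_iff)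
    have len: "length (map snd (g i)) = m ?u"
      by (simp add: g_def)
    have nth: "map snd (g i) ! j = {v \<in> pV H. {Inl v, Inr (?u, Suc j)} \<in> EG}" if "j < m ?u" for j
      using that by (simp add: g_def del: upt_Suc)
    have edges: "{Inl (lft ?u), Inr (?u, 1)} \<in> EG" "{Inl (rgt ?u), Inr (?u, m ?u)} \<in> EG"
      using pe by (auto simp: path_edges_def insert_commute)
    have spokes: "\<exists>S\<in>set (map snd (g i)). v \<in> S" if v: "(v, ?u) \<in> pS H" for v
    proof -
      have "\<exists>x\<in>internal m ?u. {Inl v, x} \<in> EG"
        using real v unfolding is_realization_def by fast
      then obtain j where "1 \<le> j" "j \<le> m ?u" "{Inl v, Inr (?u, j)} \<in> EG"
        unfolding internal_def by blast
      moreover have "v \<in> pV H"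
        using wf v unfolding wf_pathograph_def by auto
      ultimately have "v \<in> map snd (g i) ! (j - 1)" "j - 1 < length (map snd (g i))"
        using nth[of "j - 1"] len by auto
      then show ?thesis
        using nth_mem by blast
    qed
    have "urpath_string (lft ?u) (rgt ?u) {v. (v, ?u) \<in> pS H} (map snd (g i))"
      unfolding urpath_string_def len
    proof (intro conjI allI impI ballI)
      show "map snd (g i) \<noteq> []"
        using len m by auto
      show "lft ?u \<in> map snd (g i) ! 0" "rgt ?u \<in> map snd (g i) ! (m ?u - 1)"
        using nth[of 0] nth[of "m ?u - 1"] m edges endsV by auto
      show "v \<in> {v. (v, ?u) \<in> pS H} \<or> v = lft ?u \<and> j = 0 \<or> v = rgt ?u \<and> Suc j = m ?u"
        if "j < m ?u" "v \<in> map snd (g i) ! j" for j v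
        using realization_edge_spoke[OF real, of v ?u "Suc j"] that(2) unfolding nth[OF that(1)] by auto
    qed (use spokes in auto)
    moreover have "g i \<in> lists ({Suc i} \<times> UNIV)"
      by (auto simp: g_def)
    ultimately show ?thesis
      by (simp add: block_def)
  qed
  moreover have "determination_string H us m EG = concat (map g [0..<length us])"
    unfolding determination_string_def g_def ..
  ultimately show ?thesis
    by blast
qed

text \<open>The string dictates the whole graph: the block lengths are the numbers of interior
  vertices and the letters give their neighbours in H. In the absence of rungs nothing else is left
  to choose.\<close>

lemma blocks_imp_realization:
  fixes H :: "('v, 'u) pathograph"
  assumes wf: "wf_pathograph H" and no_rungs: "pR H = {}" and us: "distinct us" "set us = pU H"
    and ends: "\<forall>u \<in> pU H. pEnds H u = {lft u, rgt u}"
    and \<sigma>: "concat (map g [0..<length us]) \<in> lists (A \<times> Pow (pV H))"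
    and block: "\<forall>i<length us. block H lft rgt us i (g i)"
  shows "\<exists>m EG. is_realization H lft rgt m EG \<and> concat (map g [0..<length us]) = determination_string H us m EG"
proof -
  have us_inj: "i = i'" if "i < length us" "i' < length us" "us ! i = us ! i'" for i i'
    using that us(1) by (simp add: nth_eq_iff_index_eq)
  have "\<exists>i<length us. us ! i = u" if "u \<in> pU H" for u
    using that unfolding us(2)[symmetric] in_set_conv_nth .
  then obtain idx where idx: "\<And>u. u \<in> pU H \<Longrightarrow> idx u < length us" "\<And>u. u \<in> pU H \<Longrightarrow> us ! idx u = u"
    by metis
  have us_nth: "us ! i \<in> pU H" if "i < length us" for i
    unfolding us(2)[symmetric] using that by (rule nth_mem)
  have idx_nth: "idx (us ! i) = i" if "i < length us" for i
    using idx us_nth[OF that] us_inj that by blast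
  define \<tau> where "\<tau> u = map snd (g (idx u))" for u
  define m where "m u = length (\<tau> u)" for u
  have string: "urpath_string (lft u) (rgt u) {v. (v, u) \<in> pS H} (\<tau> u)" if "u \<in> pU H" for u
    using block idx[OF that] by (auto simp: block_def \<tau>_def)
  have \<tau>V: "\<tau> u ! j \<subseteq> pV H" if "u \<in> pU H" "j < m u" for u j
  proof -
    have "g (idx u) ! j \<in> set (g (idx u))"
      using that by (simp add: m_def \<tau>_def)
    then have "g (idx u) ! j \<in> set (concat (map g [0..<length us]))"
      using idx(1)[OF that(1)] by auto
    then have "g (idx u) ! j \<in> A \<times> Pow (pV H)"
      using \<sigma> by (meson in_listsD)
    then show ?thesis
      using that by (auto simp: \<tau>_def m_def mem_Times_iff)
  qed
  have m: "1 \<le> m u" and \<tau>_ends: "lft u \<in> \<tau> u ! 0" "rgt u \<in> \<tau> u ! (m u - 1)"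
    and \<tau>_sub: "\<And>j v. j < m u \<Longrightarrow> v \<in> \<tau> u ! j \<Longrightarrow> (v, u) \<in> pS H \<or> v = lft u \<and> j = 0 \<or> v = rgt u \<and> Suc j = m u"
    and \<tau>_spoke: "\<And>v. (v, u) \<in> pS H \<Longrightarrow> \<exists>j<m u. v \<in> \<tau> u ! j"
    if "u \<in> pU H" for u
    using string[OF that] by (auto simp: urpath_string_def m_def Suc_le_eq in_set_conv_nth Bex_def)
  \<comment> \<open>Letters of a block are counted from 0, interior vertices from 1.\<close>
  define X :: "('v + 'u \<times> nat) set set" where
    "X = {{Inl v, Inr (u, Suc j)} |v u j. u \<in> pU H \<and> j < m u \<and> v \<in> \<tau> u ! j}"
  define EG where "EG = (image Inl) ` pE H \<union> (\<Union>u \<in> pU H. path_edges lft rgt m u) \<union> X"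
  have X: "{Inl v, Inr (u, Suc j)} \<in> X" if "u \<in> pU H" "j < m u" "v \<in> \<tau> u ! j" for u j v
    unfolding X_def using that by blast
  \<comment> \<open>The path edges at the two ends add no neighbour, since the block condition
    already puts \<open>lft u\<close> into the first letter and \<open>rgt u\<close> into the
    last.\<close>
  have edge: "{Inl v, Inr (u, Suc j)} \<in> EG \<longleftrightarrow> v \<in> \<tau> u ! j" if u: "u \<in> pU H" "j < m u" for u v j
  proof
    assume "{Inl v, Inr (u, Suc j)} \<in> EG"
    then have "v = lft u \<and> j = 0 \<or> v = rgt u \<and> Suc j = m u \<or> v \<in> \<tau> u ! j"
      unfolding EG_def X_def by (auto simp: path_edges_def doubleton_eq_iff)
    then show "v \<in> \<tau> u ! j"
      using \<tau>_ends[OF u(1)] by (metis diff_Suc_1)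
  next
    assume "v \<in> \<tau> u ! j"
    then show "{Inl v, Inr (u, Suc j)} \<in> EG"
      unfolding EG_def using X u by blast
  qed
  have "is_realization H lft rgt m EG"
    unfolding is_realization_def
  proof (intro conjI)
    show "\<forall>u\<in>pU H. pEnds H u = {lft u, rgt u} \<and> 1 \<le> m u"
      using ends m by blast
    show "(image Inl) ` pE H \<subseteq> EG" "\<forall>u\<in>pU H. path_edges lft rgt m u \<subseteq> EG"
      unfolding EG_def by blast+
    show "EG \<subseteq> (image Inl) ` pE H \<union> (\<Union>u\<in>pU H. path_edges lft rgt m u) \<union> spoke_edges H m \<union> rung_edges H m"
    proof -
      have "X \<subseteq> (\<Union>u\<in>pU H. path_edges lft rgt m u) \<union> spoke_edges H m"
      proof
        fix e assume "e \<in> X"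
        then obtain v u j where e: "e = {Inl v, Inr (u, Suc j)}" "u \<in> pU H" "j < m u" "v \<in> \<tau> u ! j"
          unfolding X_def by blast
        have int: "Inr (u, Suc j) \<in> internal m u"
          using e by (simp add: internal_def)
        consider "(v, u) \<in> pS H" | "v = lft u" "j = 0" | "v = rgt u" "Suc j = m u"
          using \<tau>_sub[OF e(2-4)] by blast
        then show "e \<in> (\<Union>u\<in>pU H. path_edges lft rgt m u) \<union> spoke_edges H m"
        proof cases
          case 1
          then have "e \<in> spoke_edges H m"
            unfolding spoke_edges_def e(1) using int by blast
          then show ?thesis
            by blast
        next
          case 2
          then have "e \<in> path_edges lft rgt m u"
            unfolding path_edges_def e(1) by simp
          then show ?thesis
            using e(2) by blast
        next
          case 3
          then have "e \<in> path_edges lft rgt m u"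
            unfolding path_edges_def e(1) by (simp add: insert_commute)
          then show ?thesis
            using e(2) by blast
        qed
      qed
      then show ?thesis
        unfolding EG_def by blast
    qed
    show "\<forall>(v, u)\<in>pS H. \<exists>x\<in>internal m u. {Inl v, x} \<in> EG"
    proof (rule ballI, clarify)
      fix v u assume vu: "(v, u) \<in> pS H"
      then have u: "u \<in> pU H"
        using wf unfolding wf_pathograph_def by auto
      then obtain j where "j < m u" "v \<in> \<tau> u ! j"
        using \<tau>_spoke vu by blast
      then have "{Inl v, Inr (u, Suc j)} \<in> EG" "Inr (u, Suc j) \<in> internal m u"
        using edge[OF u] by (simp_all add: internal_def)
      then show "\<exists>x\<in>internal m u. {Inl v, x} \<in> EG"
        by blast
    qed
    show "\<forall>u u'. {u, u'} \<in> pR H \<and> u \<noteq> u' \<longrightarrow> (\<exists>x\<in>internal m u. \<exists>y\<in>internal m u'. {x, y} \<in> EG)"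
      using no_rungs by simp
  qed
  moreover have "g i = map (\<lambda>j. (Suc i, {v \<in> pV H. {Inl v, Inr (us ! i, j)} \<in> EG})) [1..<Suc (m (us ! i))]"
    (is "_ = ?w") if i: "i < length us" for i
  proof (rule nth_equalityI)
    show "length (g i) = length ?w"
      by (simp add: m_def \<tau>_def idx_nth[OF i] del: upt_Suc)
  next
    fix j assume j: "j < length (g i)"
    then have jm: "j < m (us ! i)"
      by (simp add: m_def \<tau>_def idx_nth[OF i])
    have "snd (g i ! j) = \<tau> (us ! i) ! j"
      using j by (simp add: \<tau>_def idx_nth[OF i])
    moreover have "\<tau> (us ! i) ! j = {v \<in> pV H. {Inl v, Inr (us ! i, Suc j)} \<in> EG}"
      using edge[OF us_nth[OF i] jm] \<tau>V[OF us_nth[OF i] jm] by auto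
    moreover have "fst (g i ! j) = Suc i"
    proof -
      have "g i \<in> lists ({Suc i} \<times> UNIV)"
        using block i by (simp add: block_def)
      then have "g i ! j \<in> {Suc i} \<times> UNIV"
        using nth_mem[OF j] by (rule in_listsD[THEN bspec])
      then show ?thesis
        by (simp add: mem_Times_iff)
    qed
    ultimately have "g i ! j = (Suc i, {v \<in> pV H. {Inl v, Inr (us ! i, Suc j)} \<in> EG})"
      by (simp add: prod_eq_iff)
    then show "g i ! j = ?w ! j"
      using jm by (simp del: upt_Suc)
  qed
  then have "concat (map g [0..<length us]) = determination_string H us m EG"
    unfolding determination_string_def by (intro arg_cong[of _ _ concat] map_cong) auto
  ultimately show ?thesis
    by blast
qed

theorem theorem7:
  fixes H :: "('v, 'u) pathograph"
    and us :: "'u list"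
    and lft rgt :: "'u \<Rightarrow> 'v"
    and \<F> :: "('a, 'b) pathograph set"
  assumes "wf_pathograph H"
    and "pR H = {}"
    and "distinct us" and "set us = pU H"
    and "\<forall>u \<in> pU H. pEnds H u = {lft u, rgt u}"
    and "finite \<F>" and "\<forall>F \<in> \<F>. wf_pathograph F"
  shows "\<exists>(Q :: nat set) \<delta> q0 Acc.
           is_dfa Q ({1..length us} \<times> Pow (pV H)) \<delta> q0 Acc \<and>
           (\<forall>\<sigma> \<in> lists ({1..length us} \<times> Pow (pV H)).
              dfa_accepts \<delta> q0 Acc \<sigma> \<longleftrightarrow>
              (\<exists>m EG. is_realization H lft rgt m EG \<and>
                  pathograph_free (real_vertices H m) EG \<F> \<and>
                  \<sigma> = determination_string H us m EG))"
proof -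
  let ?\<Sigma> = "{1..length us} \<times> Pow (pV H)"
  let ?\<Gamma> = "Inl ` pV H \<union> Inr ` ?\<Sigma>"
  have finV: "finite (pV H)"
    using assms(1) by (simp add: wf_pathograph_def)
  \<comment> \<open>Any order of the vertices will do, since adjacency between distinct positions
    with vertex letters depends on the letters alone.\<close>
  obtain vl where vl: "distinct vl" "set vl = pV H"
    using finite_distinct_list[OF finV] by blast
  define C where "C F w \<longleftrightarrow> contains_pathograph {..<length w} {{p, q} |p q. word_adj (letter_far H) letter_near w p q} F"
    for F :: "('a, 'b) pathograph" and w :: "('v + nat \<times> 'v set) list"
  have regular_C: "regular ?\<Sigma> (\<lambda>\<sigma>. C F (map Inl vl @ map Inr \<sigma>))" if F: "F \<in> \<F>" for F
  proof -
    have "regular ?\<Gamma> (C F)"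
      unfolding C_def
      by (rule regular_contains_pathograph) (use F assms(7) finV symp_letter_far in auto)
    moreover have "map Inl vl \<in> lists ?\<Gamma>"
      using vl(2) by auto
    ultimately have "regular ?\<Gamma> (\<lambda>w. C F (map Inl vl @ w))"
      by (rule regular_left_quotient)
    then show ?thesis
      by (rule regular_map) auto
  qed
  define P where "P \<sigma> \<longleftrightarrow>
      (\<exists>g. \<sigma> = concat (map g [0..<length us]) \<and> (\<forall>i<length us. block H lft rgt us i (g i))) \<and>
      (\<forall>F\<in>\<F>. \<not> C F (map Inl vl @ map Inr \<sigma>))" for \<sigma>
  have "lft (us ! i) \<noteq> rgt (us ! i)" if "i < length us" for i
  proof -
    have "us ! i \<in> pU H"
      unfolding assms(4)[symmetric] using that by (rule nth_mem)
    then have "{lft (us ! i), rgt (us ! i)} \<in> doubletons (pV H)"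
      using assms(1,5) unfolding wf_pathograph_def by metis
    then show ?thesis
      by (auto simp: doubletons_def doubleton_eq_iff)
  qed
  then have regular_P: "regular ?\<Sigma> P"
    unfolding P_def by (intro regular_conj regular_concat regular_block regular_ball regular_not regular_C assms)
  \<comment> \<open>Freeness depends on the determination string alone, so whichever realization is
    rebuilt from the blocks may serve as the witness.\<close>
  have free: "pathograph_free (real_vertices H m) EG \<F> \<longleftrightarrow> (\<forall>F\<in>\<F>. \<not> C F (map Inl vl @ map Inr (determination_string H us m EG)))"
    if "is_realization H lft rgt m EG" for m EG
    unfolding pathograph_free_def C_def
    using contains_pathograph_realization_iff[OF that assms(2-4) vl refl] by blast
  have "P \<sigma> \<longleftrightarrow> (\<exists>m EG. is_realization H lft rgt m EG \<and>
      pathograph_free (real_vertices H m) EG \<F> \<and> \<sigma> = determination_string H us m EG)" (is "_ \<longleftrightarrow> ?R")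
    if \<sigma>: "\<sigma> \<in> lists ?\<Sigma>" for \<sigma>
  proof
    assume P: "P \<sigma>"
    then obtain g where g: "\<sigma> = concat (map g [0..<length us])" "\<forall>i<length us. block H lft rgt us i (g i)"
      unfolding P_def by blast
    obtain m EG where "is_realization H lft rgt m EG" "\<sigma> = determination_string H us m EG"
      using blocks_imp_realization[OF assms(1-5) \<sigma>[unfolded g(1)] g(2)] unfolding g(1) by blast
    then show ?R
      using free P unfolding P_def by blast
  next
    assume ?R
    then obtain m EG where R: "is_realization H lft rgt m EG" "pathograph_free (real_vertices H m) EG \<F>"
      "\<sigma> = determination_string H us m EG"
      by blast
    then show "P \<sigma>"
      using realization_imp_blocks[OF assms(1,4) R(1)] free[OF R(1)] by (simp add: P_def)
  qed
  with regular_imp_dfa[OF regular_P] show ?thesis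
    by simp
qed

end
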